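(* Let $K$ be a field and let $n,t,p,d$ be integers such that $n\ge 2$, $2\le t\le n$, $n=(t+1)p+d$, where $p\ge 0$ and $0\le d\le t$. Let $R=K[x_1,\dots,x_n]$ and let $I_t(C_n)\subset R$ be the path ideal of the cycle $C_n$. Then (i) the projective dimension is $$\mathrm{pd}(R/I_t(C_n))=\begin{cases}2p+1 & d\neq 0,\\ 2p & d=0;\end{cases}$$ (ii) the regularity is $$\mathrm{reg}(R/I_t(C_n))=\begin{cases}(t-1)p+d-1 & d\neq 0,\\ (t-1)p & d=0.\end{cases}$$
   Context: The path ideal $I_t(C_n)$ is the ideal of $R=K[x_1,\dots,x_n]$ generated by the monomials $x_{i}x_{i+1}\cdots x_{i+t-1}$, $1\le i\le n$, with indices taken modulo $n$ in $\{1,\dots,n\}$ (one monomial for each path on $t$ vertices in the cycle $C_n$ with edges $\{x_1,x_2\},\dots,\{x_{n-1},x_n\},\{x_n,x_1\}$). $R$ is standard graded, and $\beta_{i,j}(R/I)$ denotes the number of copies of $R(-j)$ in homological degree $i$ of the minimal graded free resolution of $R/I$ (with $R$ itself in homological degree $0$). The projective dimension of $R/I$ is $\max\{i : \beta_{i,j}(R/I)\neq 0\text{ for some }j\}$ and the regularity of $R/I$ is $\max\{j-i : \beta_{i,j}(R/I)\neq 0\}$. *)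

theory Defs
  imports "HOL-Library.Poly_Mapping" "Jordan_Normal_Form.Matrix_Kernel"
begin

type_synonym 'k mpoly = "(nat \<Rightarrow>\<^sub>0 nat) \<Rightarrow>\<^sub>0 'k"

definition Var :: "nat \<Rightarrow> 'k::field mpoly" where
  "Var i = Poly_Mapping.single (Poly_Mapping.single i 1) 1"

text \<open>The ring \<open>R = K[x\<^sub>1,\<dots>,x\<^sub>n]\<close>, as the subring of polynomials involving only these variables.\<close>

definition polys :: "nat \<Rightarrow> 'k::field mpoly set" where
  "polys n = {f. \<forall>m\<in>Poly_Mapping.keys f. Poly_Mapping.keys m \<subseteq> {1..n}}"

definition ideal_gen :: "nat \<Rightarrow> 'k::field mpoly set \<Rightarrow> 'k mpoly set" where
  "ideal_gen n G = {\<Sum>g\<in>T. c g * g | T c. finite T \<and> T \<subseteq> G \<and> (\<forall>g\<in>T. c g \<in> polys n)}"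

definition cycle_path_monomial :: "nat \<Rightarrow> nat \<Rightarrow> nat \<Rightarrow> 'k::field mpoly" where
  "cycle_path_monomial n t i = (\<Prod>j<t. Var ((i - 1 + j) mod n + 1))"

definition path_ideal_cycle :: "nat \<Rightarrow> nat \<Rightarrow> 'k::field mpoly set" where
  "path_ideal_cycle n t = ideal_gen n (cycle_path_monomial n t ` {1..n})"

definition monomial_degree :: "(nat \<Rightarrow>\<^sub>0 nat) \<Rightarrow> nat" where
  "monomial_degree m = (\<Sum>x\<in>Poly_Mapping.keys m. Poly_Mapping.lookup m x)"

text \<open>The zero polynomial is homogeneous of every degree; only it is so in negative degrees.\<close>

definition homogeneous :: "int \<Rightarrow> 'k::field mpoly \<Rightarrow> bool" where
  "homogeneous e f \<longleftrightarrow> (\<forall>m\<in>Poly_Mapping.keys f. int (monomial_degree m) = e)"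

definition free_module :: "nat \<Rightarrow> nat \<Rightarrow> 'k::field mpoly vec set" where
  "free_module n r = {v \<in> carrier_vec r. \<forall>k<r. v $ k \<in> polys n}"

text \<open>
  A minimal graded free resolution
  \<open>\<dots> \<longrightarrow> F\<^sub>2 \<longrightarrow> F\<^sub>1 \<longrightarrow> F\<^sub>0 = R \<longrightarrow> R/I \<longrightarrow> 0\<close> for a proper homogeneous ideal \<open>I\<close>.
  The list \<open>a i\<close> holds the shifts of \<open>F\<^sub>i\<close>, i.e. \<open>F\<^sub>i\<close> is the direct sum of the
  \<open>R(-j)\<close> for \<open>j\<close> in \<open>a i\<close>, and the matrix \<open>D i\<close> represents the map
  \<open>F\<^sub>i\<^sub>+\<^sub>1 \<longrightarrow> F\<^sub>i\<close>. This map has degree \<open>0\<close> iff the entry in row \<open>r\<close> and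
  column \<open>c\<close> is homogeneous of degree \<open>a (i+1) ! c - a i ! r\<close>. The last conjunct says
  that the image of \<open>F\<^sub>i\<^sub>+\<^sub>1\<close> lies in \<open>(x\<^sub>1,\<dots>,x\<^sub>n) F\<^sub>i\<close>.
\<close>

definition minimal_graded_free_resolution ::
  "nat \<Rightarrow> 'k::field mpoly set \<Rightarrow> (nat \<Rightarrow> int list) \<Rightarrow> (nat \<Rightarrow> 'k mpoly mat) \<Rightarrow> bool" where
  "minimal_graded_free_resolution n I a D \<longleftrightarrow>
     a 0 = [0] \<and>
     (\<forall>i. D i \<in> carrier_mat (length (a i)) (length (a (Suc i)))) \<and>
     (\<forall>i. \<forall>r<length (a i). \<forall>c<length (a (Suc i)).
        D i $$ (r, c) \<in> polys n \<and> homogeneous (a (Suc i) ! c - a i ! r) (D i $$ (r, c))) \<and>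
     (\<lambda>v. D 0 *\<^sub>v v) ` free_module n (length (a 1)) = {v \<in> free_module n 1. v $ 0 \<in> I} \<and>
     (\<forall>i. (\<lambda>v. D (Suc i) *\<^sub>v v) ` free_module n (length (a (Suc (Suc i)))) =
        mat_kernel (D i) \<inter> free_module n (length (a (Suc i)))) \<and>
     (\<forall>i. \<forall>r<length (a i). \<forall>c<length (a (Suc i)). Poly_Mapping.lookup (D i $$ (r, c)) 0 = 0)"

text \<open>\<open>\<beta>\<^sub>i\<^sub>,\<^sub>j(R/I)\<close>. Minimal graded free resolutions are unique up to isomorphism, so all of them
  give the same numbers. The two invariants below are also those of the quotient \<open>R/I\<close>, not of
  the ideal \<open>I\<close>.\<close>

definition betti :: "nat \<Rightarrow> 'k::field mpoly set \<Rightarrow> nat \<Rightarrow> int \<Rightarrow> nat" where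
  "betti n I i j =
     (THE b. \<exists>a D. minimal_graded_free_resolution n I a D \<and> b = count_list (a i) j)"

definition proj_dim :: "nat \<Rightarrow> 'k::field mpoly set \<Rightarrow> nat" where
  "proj_dim n I = Max {i. \<exists>j. betti n I i j \<noteq> 0}"

definition regularity :: "nat \<Rightarrow> 'k::field mpoly set \<Rightarrow> int" where
  "regularity n I = Max {j - int i | i j. betti n I i j \<noteq> 0}"

end

theory Submission
  imports Defs
begin

text \<open>
  A minimal resolution of a squarefree monomial ideal is determined by scalar matrices together with
  the multidegrees of the basis elements. If \<open>J\<close> and \<open>J : \<tau>\<close> are resolved, the mapping cone of
  multiplication by \<open>\<tau>\<close> resolves \<open>J + (\<tau>)\<close>. Adding the paths one at a time, every colon ideal is
  again the path ideal of a shorter line, enlarged by an initial segment and possibly by one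
  variable, so resolutions of \<open>I\<^sub>t(C\<^sub>n)\<close> arise recursively. They need not be minimal, but all their
  positions \<open>(i, j)\<close> satisfy \<open>i \<le> P\<close> and \<open>j - i \<le> r\<close>, and the corner \<open>(P, P + r)\<close> is occupied,
  where \<open>P\<close> and \<open>r\<close> are the claimed invariants. Minimization cancels pairs in positions \<open>(i, j)\<close>
  and \<open>(i + 1, j)\<close>, and neither partner of the corner lies within these bounds; so the corner
  survives and both maxima are attained there.

  The Betti numbers are well defined because the differential of a minimal resolution vanishes modulo
  the variables. Hence a chain map that is homotopic to the identity is the identity modulo the
  variables, and comparison maps in both directions are mutually inverse there, degree by degree.
\<close>

section \<open>Multigraded resolutions over the field\<close>

text \<open>The constants come from the colon step for a line with an initial segment of
  \<open>s\<close> vertices: the colon by that segment is again such a line, \<open>s\<close>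
  vertices shorter, whose initial segment has \<open>t + 1 - s\<close> vertices. Two steps restore
  \<open>s\<close>, use up \<open>t + 1\<close> vertices, raise the homological degree by 2 and the
  internal degree by \<open>t + 1\<close>, hence the regularity by \<open>t - 1\<close>.

  Scalars suffice because all multidegrees stay squarefree. The strand in a multidegree then depends
  only on its support, so exactness is linear algebra over the field in finitely many coordinates.
  It is stated for all homological degrees at once, for cycles of possibly mixed degree; the
  alternative \<open>v z = 0 \<or> \<sigma> \<in> I\<close> adds that the cokernel at
  \<open>z\<close> is the quotient by the ideal.\<close>

definition mulv :: "'b set \<Rightarrow> ('b \<Rightarrow> 'b \<Rightarrow> 'k::field) \<Rightarrow> ('b \<Rightarrow> 'k) \<Rightarrow> 'b \<Rightarrow> 'k" where
  "mulv B d v x = (\<Sum>y\<in>B. d x y * v y)"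

definition strand :: "'b set \<Rightarrow> ('b \<Rightarrow> nat set) \<Rightarrow> nat set \<Rightarrow> ('b \<Rightarrow> 'k::field) set" where
  "strand B \<mu> \<sigma> = {v. \<forall>b. v b \<noteq> 0 \<longrightarrow> b \<in> B \<and> \<mu> b \<subseteq> \<sigma>}"

lemma mulv_add: "mulv B d (\<lambda>x. v x + w x) = (\<lambda>x. mulv B d v x + mulv B d w x)"
  by (simp add: mulv_def fun_eq_iff distrib_left sum.distrib)

lemma mulv_scale: "mulv B d (\<lambda>x. a * v x) = (\<lambda>x. a * mulv B d v x)"
  by (simp add: mulv_def fun_eq_iff sum_distrib_left mult.left_commute)

lemma mulv_unit:
  assumes "finite B" and "c \<in> B"
  shows "mulv B d (\<lambda>x. if x = c then a else 0) = (\<lambda>x. d x c * a)"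
  using assms by (simp add: mulv_def fun_eq_iff if_distrib cong: if_cong)

text \<open>
  The squarefree monomial ideal is represented by the set \<open>I\<close> of the supports of its monomials. The
  basis element \<open>b\<close> has homological degree \<open>h b\<close> and the squarefree multidegree \<open>\<mu> b\<close>; the entry of
  the differential in row \<open>b\<close> and column \<open>c\<close> is \<open>d b c\<close> times the monomial with support
  \<open>\<mu> c - \<mu> b\<close>. In every multidegree with support \<open>\<sigma>\<close> the resolution is then the complex of vector
  spaces spanned by the basis elements with \<open>\<mu> b \<subseteq> \<sigma>\<close>.
\<close>

locale scalar_resolution =
  fixes I :: "nat set set" and B :: "'b set" and h :: "'b \<Rightarrow> nat" and \<mu> :: "'b \<Rightarrow> nat set"
    and d :: "'b \<Rightarrow> 'b \<Rightarrow> 'k::field" and z :: 'b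
  assumes up: "\<sigma> \<in> I \<Longrightarrow> \<sigma> \<subseteq> \<sigma>' \<Longrightarrow> \<sigma>' \<in> I"
    and fin: "finite B"
    and base: "z \<in> B" "h z = 0" "\<mu> z = {}"
    and base_unique: "b \<in> B \<Longrightarrow> h b = 0 \<Longrightarrow> b = z"
    and supp: "d b c \<noteq> 0 \<Longrightarrow> b \<in> B \<and> c \<in> B \<and> h c = Suc (h b) \<and> \<mu> b \<subseteq> \<mu> c"
    and square: "(\<Sum>y\<in>B. d x y * d y c) = 0"
    and augmented: "d z c \<noteq> 0 \<Longrightarrow> \<mu> c \<in> I"
    and exact: "v \<in> strand B \<mu> \<sigma> \<Longrightarrow> mulv B d v = (\<lambda>_. 0) \<Longrightarrow> v z = 0 \<or> \<sigma> \<in> I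
      \<Longrightarrow> \<exists>w\<in>strand B \<mu> \<sigma>. v = mulv B d w"
begin

lemma mulv_mulv: "mulv B d (mulv B d v) = (\<lambda>_. 0)"
proof
  fix x
  have "mulv B d (mulv B d v) x = (\<Sum>c\<in>B. \<Sum>y\<in>B. d x y * d y c * v c)"
    unfolding mulv_def by (subst sum.swap) (simp add: sum_distrib_left mult.assoc)
  also have "\<dots> = 0" by (simp add: square flip: sum_distrib_right)
  finally show "mulv B d (mulv B d v) x = 0" .
qed

lemma mulv_nonzero:
  assumes "mulv B d v x \<noteq> 0" obtains y where "y \<in> B" "d x y \<noteq> 0" "v y \<noteq> 0"
proof -
  obtain y where "y \<in> B" "d x y * v y \<noteq> 0"
    using assms unfolding mulv_def by (rule sum.not_neutral_contains_not_neutral)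
  then show thesis using that by auto
qed

lemma mulv_strand: "v \<in> strand B \<mu> \<sigma> \<Longrightarrow> mulv B d v \<in> strand B \<mu> \<sigma>"
  unfolding strand_def using supp by (auto elim!: mulv_nonzero; blast)

lemma mulv_base:
  assumes "v \<in> strand B \<mu> \<sigma>" and "mulv B d v z \<noteq> 0" shows "\<sigma> \<in> I"
proof -
  obtain y where "d z y \<noteq> 0" "v y \<noteq> 0" using assms(2) by (rule mulv_nonzero)
  then show ?thesis using assms(1) augmented up[of "\<mu> y" \<sigma>] unfolding strand_def by auto
qed

lemma no_loop: "d b b = 0" "h b = 0 \<Longrightarrow> d x b = 0"
  using supp[of b b] supp[of x b] by auto

lemma mulv_unit_base: "mulv B d (\<lambda>x. if x = z then a else 0) = (\<lambda>_. 0)"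
  using no_loop(2)[of z] base fin by (simp add: mulv_unit)

lemma unit_strand: "c \<in> B \<Longrightarrow> \<mu> c \<subseteq> \<sigma> \<Longrightarrow> (\<lambda>x. if x = c then a else 0) \<in> strand B \<mu> \<sigma>"
  by (auto simp: strand_def)

text \<open>\<open>exact\<close> returns a preimage of mixed homological degree. The differential
  lowers the degree by exactly one, so for a vector concentrated in one degree the component of the
  preimage just above it is already a preimage.\<close>

lemma mulv_restrict:
  assumes v: "v = mulv B d w" and hom: "\<And>x. v x \<noteq> 0 \<Longrightarrow> Suc (h x) = k"
  shows "v = mulv B d (\<lambda>b. if h b = k then w b else 0)"
proof
  fix x
  have eq: "d x y * w y = d x y * (if h y = k then w y else 0)" if "Suc (h x) = k" for y
    using that supp[of x y] by auto
  have zero: "d x y * (if h y = k then w y else 0) = 0" if "Suc (h x) \<noteq> k" for y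
    using that supp[of x y] by (cases "d x y = 0") auto
  show "v x = mulv B d (\<lambda>b. if h b = k then w b else 0) x"
  proof (cases "Suc (h x) = k")
    case True
    show ?thesis unfolding v mulv_def by (rule sum.cong[OF refl], rule eq[OF True])
  next
    case False
    then have "v x = 0" using hom by blast
    then show ?thesis unfolding mulv_def by (simp only: zero[OF False] sum.neutral_const)
  qed
qed

end

text \<open>\<open>\<phi>\<close> lifts multiplication by the monomial with support
  \<open>\<tau>\<close>, a map from the quotient by the colon ideal to the quotient by
  \<open>J\<close>. The columns of lower homological degree, combined with the coefficients
  \<open>dG _ c\<close>, form a cycle of \<open>F\<close>; exactness bounds it, and the bounding
  vector is column \<open>c\<close>.\<close>

lemma comparison_map:
  fixes dF :: "'b \<Rightarrow> 'b \<Rightarrow> 'k::field" and dG :: "'c \<Rightarrow> 'c \<Rightarrow> 'k"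
  assumes F: "scalar_resolution J BF hF \<mu>F dF zF"
    and G: "scalar_resolution {\<sigma>. \<sigma> \<union> \<tau> \<in> J} BG hG \<mu>G dG zG"
  obtains \<phi> :: "'b \<Rightarrow> 'c \<Rightarrow> 'k" where
    "\<And>b c. \<phi> b c \<noteq> 0 \<Longrightarrow> b \<in> BF \<and> c \<in> BG \<and> hF b = hG c \<and> \<mu>F b \<subseteq> \<mu>G c \<union> \<tau>"
    "\<And>x c. (\<Sum>y\<in>BF. dF x y * \<phi> y c) = (\<Sum>y\<in>BG. \<phi> x y * dG y c)"
    "\<phi> zF zG = 1"
proof -
  interpret F: scalar_resolution J BF hF \<mu>F dF zF by fact
  interpret G: scalar_resolution "{\<sigma>. \<sigma> \<union> \<tau> \<in> J}" BG hG \<mu>G dG zG by fact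
  define S where "S c w \<longleftrightarrow> (\<forall>b. w b \<noteq> 0 \<longrightarrow> b \<in> BF \<and> c \<in> BG \<and> hF b = hG c \<and> \<mu>F b \<subseteq> \<mu>G c \<union> \<tau>)"
    for c and w :: "'b \<Rightarrow> 'k"
  \<comment> \<open>Only columns of lower homological degree enter the sum, which makes
    \<open>P\<close> fit for well-founded recursion on \<open>hG\<close>; by \<open>lower\<close>
    the restricted sum is the full one.\<close>
  define P where "P X c w \<longleftrightarrow> S c w \<and>
      mulv BF dF w = (\<lambda>x. \<Sum>y\<in>{y\<in>BG. hG y < hG c}. X y x * dG y c) \<and>
      (c = zG \<longrightarrow> w zF = 1)" for X :: "'c \<Rightarrow> 'b \<Rightarrow> 'k" and c w
  have lower: "(\<Sum>y\<in>{y\<in>BG. hG y < hG c}. f y * dG y c) = (\<Sum>y\<in>BG. f y * dG y c)" for f c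
  proof (rule sum.mono_neutral_left)
    show "\<forall>y\<in>BG - {y\<in>BG. hG y < hG c}. f y * dG y c = 0"
    proof
      fix y assume "y \<in> BG - {y\<in>BG. hG y < hG c}"
      then show "f y * dG y c = 0" using G.supp[of y c] by (cases "dG y c = 0") auto
    qed
  qed (use G.fin in auto)
  have "\<exists>X. \<forall>c. P X c (X c)"
  proof (rule dependent_wf_choice[of "measure hG"])
    show "wf (measure hG)" by simp
    show "P f c r = P g c r" if "\<And>y. (y, c) \<in> measure hG \<Longrightarrow> f y = g y" for f g c r
    proof -
      have "(\<Sum>y | y \<in> BG \<and> hG y < hG c. f y x * dG y c) =
          (\<Sum>y | y \<in> BG \<and> hG y < hG c. g y x * dG y c)" for x
        using that by (intro sum.cong) auto
      then show ?thesis unfolding P_def by simp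
    qed
    show "\<exists>r. P X c r" if IH: "\<And>y. (y, c) \<in> measure hG \<Longrightarrow> P X y (X y)" for c X
    proof -
      consider "c \<notin> BG" | "c = zG" | "c \<in> BG" "hG c > 0"
        using G.base_unique by blast
      then show ?thesis
      proof cases
        case 1
        then have "dG b c = 0" for b using G.supp[of b c] by auto
        then have "P X c (\<lambda>_. 0)"
          unfolding P_def S_def using G.base 1 by (auto simp: mulv_def)
        then show ?thesis by (rule exI[of "P X c"])
      next
        case 2
        have "P X c (\<lambda>x. if x = zF then 1 else 0)"
          unfolding P_def S_def F.mulv_unit_base using 2 F.base G.base by auto
        then show ?thesis by (rule exI[of "P X c"])
      next
        case 3
        define \<sigma> where "\<sigma> = \<mu>G c \<union> \<tau>"
        define L where "L = {y\<in>BG. hG y < hG c}"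
        have IH: "S y (X y)" "mulv BF dF (X y) x = (\<Sum>u\<in>BG. X u x * dG u y)" if "y \<in> L" for x y
        proof -
          have "P X y (X y)" using IH[of y] that unfolding L_def by simp
          then show "S y (X y)" "mulv BF dF (X y) x = (\<Sum>u\<in>BG. X u x * dG u y)"
            unfolding P_def lower by simp_all
        qed
        \<comment> \<open>The boundary of \<open>c\<close>, pushed through the columns built so far:
          column \<open>c\<close> has to be a preimage of it.\<close>
        define v where "v x = (\<Sum>y\<in>L. X y x * dG y c)" for x
        have vnz: "\<exists>y\<in>L. X y x \<noteq> 0 \<and> dG y c \<noteq> 0" if nz: "v x \<noteq> 0" for x
        proof -
          obtain y where "y \<in> L" "X y x * dG y c \<noteq> 0"
            using nz unfolding v_def by (rule sum.not_neutral_contains_not_neutral)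
          then show ?thesis by auto
        qed
        have vS: "x \<in> BF \<and> Suc (hF x) = hG c \<and> \<mu>F x \<subseteq> \<sigma>" if nz: "v x \<noteq> 0" for x
        proof -
          obtain y where y: "y \<in> L" "X y x \<noteq> 0" "dG y c \<noteq> 0" using vnz[OF nz] by blast
          then have "x \<in> BF \<and> hF x = hG y \<and> \<mu>F x \<subseteq> \<mu>G y \<union> \<tau>" using IH(1) unfolding S_def by blast
          moreover have "hG c = Suc (hG y)" "\<mu>G y \<subseteq> \<mu>G c" using G.supp[OF y(3)] by auto
          ultimately show ?thesis unfolding \<sigma>_def by auto
        qed
        then have vs: "v \<in> strand BF \<mu>F \<sigma>" unfolding strand_def by auto
        have "mulv BF dF v x = 0" for x
        proof -
          have "mulv BF dF v x = (\<Sum>y\<in>L. mulv BF dF (X y) x * dG y c)"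
            unfolding mulv_def v_def sum_distrib_left sum_distrib_right
            by (subst sum.swap) (simp add: mult.assoc)
          also have "\<dots> = (\<Sum>y\<in>L. (\<Sum>u\<in>BG. X u x * dG u y) * dG y c)"
            using IH(2) by simp
          also have "\<dots> = (\<Sum>y\<in>BG. (\<Sum>u\<in>BG. X u x * dG u y) * dG y c)"
            unfolding L_def by (rule lower)
          also have "\<dots> = (\<Sum>u\<in>BG. X u x * (\<Sum>y\<in>BG. dG u y * dG y c))"
            unfolding sum_distrib_left sum_distrib_right
            by (subst sum.swap) (simp add: mult.assoc)
          also have "\<dots> = 0" by (simp add: G.square)
          finally show ?thesis .
        qed
        \<comment> \<open>A nonzero coordinate at \<open>zF\<close> can only come from
          \<open>zG\<close>, and then \<open>augmented\<close> puts the multidegree of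
          \<open>c\<close> into the colon ideal.\<close>
        moreover have "v zF = 0 \<or> \<sigma> \<in> J"
        proof (rule disjCI)
          assume "\<sigma> \<notin> J"
          show "v zF = 0"
          proof (rule ccontr)
            assume "v zF \<noteq> 0"
            then obtain y where y: "y \<in> L" "X y zF \<noteq> 0" "dG y c \<noteq> 0" using vnz by blast
            then have "y \<in> BG \<and> hG y = 0" using IH(1)[OF y(1)] F.base unfolding S_def by auto
            then have "y = zG" using G.base_unique by blast
            then have "\<mu>G c \<union> \<tau> \<in> J" using y G.augmented by auto
            then show False using \<open>\<sigma> \<notin> J\<close> \<sigma>_def by simp
          qed
        qed
        ultimately obtain w where w: "w \<in> strand BF \<mu>F \<sigma>" "v = mulv BF dF w"
          using F.exact[OF vs] by auto
        have "P X c (\<lambda>b. if hF b = hG c then w b else 0)"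
          unfolding P_def
        proof (intro conjI)
          show "S c (\<lambda>b. if hF b = hG c then w b else 0)"
            using w(1) 3 unfolding S_def strand_def \<sigma>_def by auto
          show "mulv BF dF (\<lambda>b. if hF b = hG c then w b else 0) =
              (\<lambda>x. \<Sum>y | y \<in> BG \<and> hG y < hG c. X y x * dG y c)"
          proof
            fix x
            have "v = mulv BF dF (\<lambda>b. if hF b = hG c then w b else 0)"
              using w(2) by (rule F.mulv_restrict) (use vS in blast)
            then show "mulv BF dF (\<lambda>b. if hF b = hG c then w b else 0) x =
                (\<Sum>y | y \<in> BG \<and> hG y < hG c. X y x * dG y c)"
              unfolding L_def[symmetric] v_def[symmetric] by (rule fun_cong[OF sym])
          qed
          show "c = zG \<longrightarrow> (if hF zF = hG c then w zF else 0) = 1" using 3 G.base by auto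
        qed
        then show ?thesis by (rule exI[of "P X c"])
      qed
    qed
  qed
  then obtain X where X: "P X c (X c)" for c by auto
  show thesis
  proof (rule that[of "\<lambda>b c. X c b"])
    show "b \<in> BF \<and> c \<in> BG \<and> hF b = hG c \<and> \<mu>F b \<subseteq> \<mu>G c \<union> \<tau>" if "X c b \<noteq> 0" for b c
      using X[of c] that unfolding P_def S_def by auto
    show "(\<Sum>y\<in>BF. dF x y * X c y) = (\<Sum>y\<in>BG. X y x * dG y c)" for x c
      using X[of c] unfolding P_def lower by (auto simp: mulv_def fun_eq_iff)
    show "X zG zF = 1" using X[of zG] unfolding P_def by auto
  qed
qed

section \<open>Mapping cones and minimization\<close>

text \<open>Behind it is the exact sequence 0 -> R/(J : \<tau>) -> R/J -> R/(J + (\<tau>)) -> 0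
  whose first map multiplies by the monomial of \<open>\<tau>\<close>. Exactness of the cone is
  checked directly in each strand.\<close>

lemma mapping_cone:
  fixes dF :: "'b \<Rightarrow> 'b \<Rightarrow> 'k::field" and dG :: "'c \<Rightarrow> 'c \<Rightarrow> 'k"
  assumes F: "scalar_resolution J BF hF \<mu>F dF zF"
    and G: "scalar_resolution {\<sigma>. \<sigma> \<union> \<tau> \<in> J} BG hG \<mu>G dG zG"
  obtains d :: "'b + 'c \<Rightarrow> 'b + 'c \<Rightarrow> 'k" where
    "scalar_resolution (J \<union> {\<sigma>. \<tau> \<subseteq> \<sigma>}) (BF <+> BG) (case_sum hF (Suc \<circ> hG))
      (case_sum \<mu>F (\<lambda>c. \<mu>G c \<union> \<tau>)) d (Inl zF)"
proof -
  interpret F: scalar_resolution J BF hF \<mu>F dF zF by fact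
  interpret G: scalar_resolution "{\<sigma>. \<sigma> \<union> \<tau> \<in> J}" BG hG \<mu>G dG zG by fact
  obtain \<phi> where
    \<phi>: "\<And>b c. \<phi> b c \<noteq> 0 \<Longrightarrow> b \<in> BF \<and> c \<in> BG \<and> hF b = hG c \<and> \<mu>F b \<subseteq> \<mu>G c \<union> \<tau>"
      "\<And>x c. (\<Sum>y\<in>BF. dF x y * \<phi> y c) = (\<Sum>y\<in>BG. \<phi> x y * dG y c)" "\<phi> zF zG = 1"
    using comparison_map[OF F G] by blast
  define B where "B = BF <+> BG"
  define h where "h = case_sum hF (Suc \<circ> hG)"
  define \<mu> where "\<mu> = case_sum \<mu>F (\<lambda>c. \<mu>G c \<union> \<tau>)"
  \<comment> \<open>The sign makes the two mixed terms in the square of \<open>d\<close> cancel,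
    \<open>dF\<close> after \<open>\<phi>\<close> against \<open>\<phi>\<close> after
    \<open>dG\<close>.\<close>
  define d where "d x y = (case x of
      Inl a \<Rightarrow> (case y of Inl b \<Rightarrow> dF a b | Inr c \<Rightarrow> \<phi> a c)
    | Inr a \<Rightarrow> (case y of Inl b \<Rightarrow> 0 | Inr c \<Rightarrow> - dG a c))" for x y
  have hs: "h (Inl x) = hF x" "h (Inr y) = Suc (hG y)"
    and \<mu>s: "\<mu> (Inl x) = \<mu>F x" "\<mu> (Inr y) = \<mu>G y \<union> \<tau>"
    and ds: "d (Inl x) (Inl x') = dF x x'" "d (Inl x) (Inr y) = \<phi> x y"
      "d (Inr y) (Inl x) = 0" "d (Inr y) (Inr y') = - dG y y'" for x x' y y'
    by (simp_all add: h_def \<mu>_def d_def)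
  have Bs: "Inl x \<in> B \<longleftrightarrow> x \<in> BF" "Inr y \<in> B \<longleftrightarrow> y \<in> BG" for x y by (auto simp: B_def)
  have sumB: "sum f B = (\<Sum>x\<in>BF. f (Inl x)) + (\<Sum>y\<in>BG. f (Inr y))" for f :: "'b + 'c \<Rightarrow> 'k"
    unfolding B_def by (simp add: sum.Plus F.fin G.fin)
  define \<Phi> where "\<Phi> g x = (\<Sum>y\<in>BG. \<phi> x y * g y)" for g x
  have mulv_Inl: "mulv B d v (Inl x) = mulv BF dF (v \<circ> Inl) x + \<Phi> (v \<circ> Inr) x"
    and mulv_Inr: "mulv B d v (Inr y) = - mulv BG dG (v \<circ> Inr) y" for v x y
    by (simp_all add: mulv_def sumB ds \<Phi>_def sum_negf)
  have \<Phi>_chain: "mulv BF dF (\<Phi> g) = \<Phi> (mulv BG dG g)" for g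
  proof
    fix x
    have "mulv BF dF (\<Phi> g) x = (\<Sum>c\<in>BG. (\<Sum>y\<in>BF. dF x y * \<phi> y c) * g c)"
      unfolding mulv_def \<Phi>_def sum_distrib_left sum_distrib_right
      by (subst sum.swap) (simp add: mult.assoc)
    also have "\<dots> = (\<Sum>c\<in>BG. (\<Sum>y\<in>BG. \<phi> x y * dG y c) * g c)" by (simp add: \<phi>(2))
    also have "\<dots> = \<Phi> (mulv BG dG g) x"
      unfolding mulv_def \<Phi>_def sum_distrib_left sum_distrib_right
      by (subst sum.swap) (simp add: mult.assoc)
    finally show "mulv BF dF (\<Phi> g) x = \<Phi> (mulv BG dG g) x" .
  qed
  have \<Phi>_base: "\<Phi> g zF = g zG" for g
  proof -
    have "\<Phi> g zF = (\<Sum>y\<in>BG. if y = zG then g y else 0)"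
      unfolding \<Phi>_def
    proof (rule sum.cong[OF refl])
      fix y assume "y \<in> BG"
      then show "\<phi> zF y * g y = (if y = zG then g y else 0)"
        using \<phi>(1)[of zF y] \<phi>(3) F.base G.base_unique[of y] by (cases "\<phi> zF y = 0") auto
    qed
    then show ?thesis using G.base G.fin by simp
  qed
  have \<Phi>_strand: "\<Phi> g \<in> strand BF \<mu>F \<sigma>" if "g \<in> strand BG \<mu>G \<sigma>" "\<tau> \<subseteq> \<sigma>" for g \<sigma>
    unfolding strand_def
  proof safe
    fix b assume "\<Phi> g b \<noteq> 0"
    then obtain y where "y \<in> BG" "\<phi> b y * g y \<noteq> 0"
      unfolding \<Phi>_def by (rule sum.not_neutral_contains_not_neutral)
    then have "b \<in> BF \<and> \<mu>F b \<subseteq> \<sigma>" using \<phi>(1)[of b y] that unfolding strand_def by auto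
    then show "b \<in> BF" "\<And>x. x \<in> \<mu>F b \<Longrightarrow> x \<in> \<sigma>" by auto
  qed
  have "scalar_resolution (J \<union> {\<sigma>. \<tau> \<subseteq> \<sigma>}) B h \<mu> d (Inl zF)"
  proof
    fix \<sigma> \<sigma>' assume "\<sigma> \<in> J \<union> {\<sigma>. \<tau> \<subseteq> \<sigma>}" "\<sigma> \<subseteq> \<sigma>'"
    then show "\<sigma>' \<in> J \<union> {\<sigma>. \<tau> \<subseteq> \<sigma>}" using F.up by auto
  next
    show "finite B" unfolding B_def using F.fin G.fin by simp
    show "Inl zF \<in> B" "h (Inl zF) = 0" "\<mu> (Inl zF) = {}" by (simp_all add: hs \<mu>s Bs F.base)
  next
    show "b = Inl zF" if "b \<in> B" "h b = 0" for b
      using that F.base_unique by (cases b) (auto simp: hs Bs)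
  next
    fix b c assume "d b c \<noteq> 0"
    then show "b \<in> B \<and> c \<in> B \<and> h c = Suc (h b) \<and> \<mu> b \<subseteq> \<mu> c"
      using F.supp G.supp \<phi>(1) by (cases b; cases c) (fastforce simp: hs \<mu>s ds Bs)+
  next
    show "(\<Sum>y\<in>B. d x y * d y c) = 0" for x c
      by (cases x; cases c) (simp_all add: sumB ds F.square G.square \<phi>(2) sum_negf)
  next
    show "\<mu> c \<in> J \<union> {\<sigma>. \<tau> \<subseteq> \<sigma>}" if "d (Inl zF) c \<noteq> 0" for c
      using that F.augmented by (cases c) (auto simp: ds \<mu>s)
  next
    fix v \<sigma>
    assume v: "v \<in> strand B \<mu> \<sigma>" and cycle: "mulv B d v = (\<lambda>_. 0)"
      and aug: "v (Inl zF) = 0 \<or> \<sigma> \<in> J \<union> {\<sigma>. \<tau> \<subseteq> \<sigma>}"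
    define f g where "f = v \<circ> Inl" and "g = v \<circ> Inr"
    have f: "f \<in> strand BF \<mu>F \<sigma>" and g: "g \<in> strand BG \<mu>G \<sigma>"
      using v unfolding strand_def f_def g_def by (force simp: \<mu>s simp flip: Bs)+
    have df: "mulv BF dF f x + \<Phi> g x = 0" for x
      using mulv_Inl[of v x] cycle unfolding f_def g_def by simp
    have dg: "mulv BG dG g = (\<lambda>_. 0)"
      using mulv_Inr[of v] cycle unfolding g_def by (auto simp: fun_eq_iff)
    show "\<exists>w\<in>strand B \<mu> \<sigma>. v = mulv B d w"
    \<comment> \<open>If \<open>\<sigma>\<close> does not contain \<open>\<tau>\<close>, the strand
      has no elements from \<open>G\<close> and the cone is just \<open>F\<close> there.\<close>
    proof (cases "\<tau> \<subseteq> \<sigma>")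
      case False
      have "g y = 0" for y using v False unfolding strand_def g_def by (auto simp: \<mu>s dest!: spec[of _ "Inr y"])
      then have g0: "g = (\<lambda>_. 0)" by auto
      then have "\<Phi> g x = 0" for x unfolding \<Phi>_def by simp
      then have "mulv BF dF f = (\<lambda>_. 0)" using df by auto
      moreover have "f zF = 0 \<or> \<sigma> \<in> J" using aug False unfolding f_def by auto
      ultimately obtain w where w: "w \<in> strand BF \<mu>F \<sigma>" "f = mulv BF dF w"
        using F.exact[OF f] by auto
      define w' :: "'b + 'c \<Rightarrow> 'k" where "w' = case_sum w (\<lambda>_. 0)"
      have "w' \<in> strand B \<mu> \<sigma>" using w(1) unfolding strand_def w'_def
        by (auto simp: Bs \<mu>s split: sum.splits)
      moreover have "v = mulv B d w'"
      proof
        fix x show "v x = mulv B d w' x"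
        proof (cases x)
          case (Inl a)
          have "w' \<circ> Inl = w" "w' \<circ> Inr = (\<lambda>_. 0)" by (auto simp: w'_def)
          then show ?thesis using fun_cong[OF w(2), of a] Inl unfolding f_def
            by (simp add: mulv_Inl \<Phi>_def)
        next
          case (Inr a)
          have "w' \<circ> Inr = (\<lambda>_. 0)" by (auto simp: w'_def)
          then show ?thesis using fun_cong[OF g0, of a] Inr unfolding g_def
            by (simp add: mulv_Inr) (simp add: mulv_def)
        qed
      qed
      ultimately show ?thesis by blast
    next
      case True
      have "g zG = 0 \<or> \<sigma> \<in> J"
      proof (rule disjCI)
        assume "\<sigma> \<notin> J"
        then have "mulv BF dF f zF = 0" using F.mulv_base f by blast
        then show "g zG = 0" using df[of zF] \<Phi>_base by simp
      qed
      then have "g zG = 0 \<or> \<sigma> \<union> \<tau> \<in> J" using True by (simp add: Un_absorb2)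
      then obtain w where w: "w \<in> strand BG \<mu>G \<sigma>" "g = mulv BG dG w"
        using G.exact[OF g dg] by auto
      \<comment> \<open>\<open>zG\<close> is a cycle, so adding a multiple of it to \<open>w\<close>
        keeps the boundary \<open>g\<close>. This multiple makes the base coordinate of
        \<open>f1\<close> vanish, so that \<open>F.exact\<close> applies even if
        \<open>\<sigma> \<notin> J\<close>.\<close>
      define a where "a = - (f zF + w zG)"
      define w1 where "w1 x = w x + (if x = zG then a else 0)" for x
      have w1s: "w1 \<in> strand BG \<mu>G \<sigma>"
        using w(1) G.base unfolding strand_def w1_def by auto
      have dw1: "mulv BG dG w1 = g"
        unfolding w1_def mulv_add G.mulv_unit_base using w(2) by simp
      define f1 where "f1 x = f x + \<Phi> w1 x" for x
      have "f1 \<in> strand BF \<mu>F \<sigma>"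
        using f \<Phi>_strand[OF w1s True] unfolding strand_def f1_def by (auto, force+)
      moreover have "mulv BF dF f1 = (\<lambda>_. 0)"
        unfolding f1_def mulv_add \<Phi>_chain dw1 using df by auto
      moreover have "f1 zF = 0" unfolding f1_def \<Phi>_base w1_def a_def by simp
      ultimately obtain f2 where f2: "f2 \<in> strand BF \<mu>F \<sigma>" "f1 = mulv BF dF f2"
        using F.exact by blast
      \<comment> \<open>The cone differential sends this to \<open>f1 - \<Phi> w1 = f\<close> in the
        first summand and, the two signs cancelling, to \<open>g\<close> in the second.\<close>
      define w' where "w' = case_sum f2 (\<lambda>x. - w1 x)"
      have w'i: "w' \<circ> Inl = f2" "w' \<circ> Inr = (\<lambda>x. (-1) * w1 x)" by (auto simp: w'_def)
      have "w' \<in> strand B \<mu> \<sigma>" using f2(1) w1s True unfolding strand_def w'_def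
        by (auto simp: Bs \<mu>s split: sum.splits)
      moreover have "v = mulv B d w'"
      proof
        fix x show "v x = mulv B d w' x"
        proof (cases x)
          case (Inl b)
          have "\<Phi> (\<lambda>x. (-1) * w1 x) b = - \<Phi> w1 b" by (simp add: \<Phi>_def sum_negf)
          then show ?thesis using fun_cong[OF f2(2), of b] Inl
            unfolding mulv_Inl Inl w'i by (simp add: f1_def f_def eq_diff_eq)
        next
          case (Inr b)
          show ?thesis unfolding Inr mulv_Inr w'i mulv_scale dw1 by (simp add: g_def)
        qed
      qed
      ultimately show ?thesis by blast
    qed
  qed
  then show thesis unfolding B_def h_def \<mu>_def by (rule that)
qed

text \<open>Every cone lives on a new sum type. Transport along an injection brings it back to one
  fixed index type, over which \<open>resolvable\<close> can quantify.\<close>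

lemma scalar_resolution_relabel:
  assumes R: "scalar_resolution I B h \<mu> d z" and inj: "inj_on e B"
  defines "g \<equiv> inv_into B e"
  shows "scalar_resolution I (e ` B) (h \<circ> g) (\<mu> \<circ> g)
    (\<lambda>x y. if x \<in> e ` B \<and> y \<in> e ` B then d (g x) (g y) else 0) (e z)"
    (is "scalar_resolution I ?B ?h ?\<mu> ?d ?z")
proof -
  interpret R: scalar_resolution I B h \<mu> d z by fact
  have ge: "g (e b) = b" if "b \<in> B" for b using that inj by (simp add: g_def)
  have dge: "?d (e x) (e y) = d x y" if "x \<in> B" "y \<in> B" for x y using that ge by simp
  show ?thesis
  proof
    show "\<sigma> \<in> I \<Longrightarrow> \<sigma> \<subseteq> \<sigma>' \<Longrightarrow> \<sigma>' \<in> I" for \<sigma> \<sigma>' by (rule R.up)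
    show "finite ?B" "?z \<in> ?B" "?h ?z = 0" "?\<mu> ?z = {}" using R.fin R.base by (auto simp: ge)
    show "b = ?z" if "b \<in> ?B" "?h b = 0" for b using that R.base_unique by (auto simp: ge)
    show "b \<in> ?B \<and> c \<in> ?B \<and> ?h c = Suc (?h b) \<and> ?\<mu> b \<subseteq> ?\<mu> c" if "?d b c \<noteq> 0" for b c
      using that R.supp by (auto simp: ge split: if_splits)
    show "(\<Sum>y\<in>?B. ?d x y * ?d y c) = 0" for x c
    proof (cases "x \<in> ?B \<and> c \<in> ?B")
      case True
      then obtain x' c' where "x = e x'" "c = e c'" "x' \<in> B" "c' \<in> B" by blast
      then have "(\<Sum>y\<in>?B. ?d x y * ?d y c) = (\<Sum>y\<in>B. d x' y * d y c')"
        by (simp add: sum.reindex[OF inj] ge)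
      then show ?thesis by (simp add: R.square)
    qed auto
    show "?\<mu> c \<in> I" if "?d ?z c \<noteq> 0" for c
      using that R.augmented by (auto simp: ge R.base split: if_splits)
  next
    fix v \<sigma>
    assume v: "v \<in> strand ?B ?\<mu> \<sigma>" and cyc: "mulv ?B ?d v = (\<lambda>_. 0)" and aug: "v ?z = 0 \<or> \<sigma> \<in> I"
    define u where "u x = (if x \<in> B then v (e x) else 0)" for x
    have "\<mu> b \<subseteq> \<sigma>" if "b \<in> B" "v (e b) \<noteq> 0" for b
      using v that ge unfolding strand_def by fastforce
    then have "u \<in> strand B \<mu> \<sigma>" unfolding strand_def u_def by auto
    moreover have "mulv B d u = (\<lambda>_. 0)"
    proof
      fix x
      show "mulv B d u x = 0"
      proof (cases "x \<in> B")
        case True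
        have "mulv ?B ?d v (e x) = mulv B d u x"
          unfolding mulv_def sum.reindex[OF inj] by (rule sum.cong) (use True in \<open>auto simp: ge u_def\<close>)
        then show ?thesis using cyc by simp
      next
        case False
        then have "d x y = 0" for y using R.supp[of x y] by auto
        then show ?thesis by (simp add: mulv_def)
      qed
    qed
    moreover have "u z = 0 \<or> \<sigma> \<in> I" using aug R.base by (simp add: u_def)
    ultimately obtain w where w: "w \<in> strand B \<mu> \<sigma>" "u = mulv B d w" using R.exact by blast
    define w' where "w' x = (if x \<in> ?B then w (g x) else 0)" for x
    have "w' \<in> strand ?B ?\<mu> \<sigma>" using w(1) unfolding strand_def w'_def by auto
    moreover have "v = mulv ?B ?d w'"
    proof
      fix x
      show "v x = mulv ?B ?d w' x"
      proof (cases "x \<in> ?B")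
        case True
        then obtain x' where x': "x = e x'" "x' \<in> B" by blast
        have "mulv ?B ?d w' (e x') = mulv B d w x'"
          unfolding mulv_def sum.reindex[OF inj] by (rule sum.cong) (use x' in \<open>auto simp: ge w'_def\<close>)
        then show ?thesis using x' w(2) by (metis u_def)
      next
        case False
        then have "v x = 0" using v unfolding strand_def by auto
        then show ?thesis using False unfolding mulv_def by auto
      qed
    qed
    ultimately show "\<exists>w\<in>strand ?B ?\<mu> \<sigma>. v = mulv ?B ?d w" by blast
  qed
qed

text \<open>\<open>Q\<close> records the occupied positions without multiplicities, since only
  extreme positions matter. \<open>U\<close> confines the multidegrees so that those of a colon
  ideal can be kept apart from \<open>\<tau>\<close>. The type argument names the field, which the
  other arguments do not determine.\<close>

definition resolvable :: "'k::field itself \<Rightarrow> nat set set \<Rightarrow> nat set \<Rightarrow> (nat \<times> nat) set \<Rightarrow> bool" where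
  "resolvable _ I U Q \<longleftrightarrow> (\<exists>(B :: nat set) h \<mu> (d :: nat \<Rightarrow> nat \<Rightarrow> 'k) z.
     scalar_resolution I B h \<mu> d z \<and> (\<forall>b\<in>B. \<mu> b \<subseteq> U) \<and> (\<lambda>b. (h b, card (\<mu> b))) ` B = Q)"

lemma resolvableI:
  fixes B :: "'b set" and d :: "'b \<Rightarrow> 'b \<Rightarrow> 'k::field"
  assumes "scalar_resolution I B h \<mu> d z" and "\<And>b. b \<in> B \<Longrightarrow> \<mu> b \<subseteq> U"
    and "(\<lambda>b. (h b, card (\<mu> b))) ` B = Q"
  shows "resolvable TYPE('k) I U Q"
proof -
  interpret scalar_resolution I B h \<mu> d z by fact
  obtain e :: "'b \<Rightarrow> nat" where e: "inj_on e B" using finite_imp_inj_to_nat_seg[OF fin] by blast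
  show ?thesis
    unfolding resolvable_def
    using scalar_resolution_relabel[OF assms(1) e] assms(2,3)
    by (intro exI conjI) (assumption, auto simp: e image_image)
qed

lemma resolvable_mono: "resolvable K I U Q \<Longrightarrow> U \<subseteq> U' \<Longrightarrow> resolvable K I U' Q"
  unfolding resolvable_def by (elim exE conjE, intro exI conjI, assumption) auto

lemma resolvable_empty: "resolvable TYPE('k::field) {} U {(0, 0)}"
proof (rule resolvableI[where B = "{()}" and h = "\<lambda>_. 0" and \<mu> = "\<lambda>_. {}" and d = "\<lambda>_ _. 0 :: 'k" and z = "()"])
  show "scalar_resolution {} {()} (\<lambda>_. 0) (\<lambda>_. {}) (\<lambda>_ _. 0 :: 'k) ()"
    by unfold_locales (auto simp: strand_def mulv_def intro!: exI[of _ "\<lambda>_. 0"])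
qed auto

text \<open>The colon ideal is resolved within \<open>U - \<tau>\<close>, so its multidegrees are
  disjoint from \<open>\<tau>\<close> and the union raises the degree by exactly
  \<open>card \<tau>\<close>.\<close>

lemma resolvable_cone:
  assumes "resolvable TYPE('k::field) J U Q" and "resolvable TYPE('k) {\<sigma>. \<sigma> \<union> \<tau> \<in> J} (U - \<tau>) Q'"
    and "\<tau> \<subseteq> U" and "finite U"
  shows "resolvable TYPE('k) (J \<union> {\<sigma>. \<tau> \<subseteq> \<sigma>}) U (Q \<union> (\<lambda>(i, j). (Suc i, j + card \<tau>)) ` Q')"
proof -
  obtain B :: "nat set" and h \<mu> and d :: "nat \<Rightarrow> nat \<Rightarrow> 'k" and z
    where F: "scalar_resolution J B h \<mu> d z" "\<forall>b\<in>B. \<mu> b \<subseteq> U" "(\<lambda>b. (h b, card (\<mu> b))) ` B = Q"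
    using assms(1) unfolding resolvable_def by blast
  obtain B' :: "nat set" and h' \<mu>' and d' :: "nat \<Rightarrow> nat \<Rightarrow> 'k" and z'
    where G: "scalar_resolution {\<sigma>. \<sigma> \<union> \<tau> \<in> J} B' h' \<mu>' d' z'" "\<forall>b\<in>B'. \<mu>' b \<subseteq> U - \<tau>"
      "(\<lambda>b. (h' b, card (\<mu>' b))) ` B' = Q'"
    using assms(2) unfolding resolvable_def by blast
  obtain dC :: "nat + nat \<Rightarrow> nat + nat \<Rightarrow> 'k" where C: "scalar_resolution (J \<union> {\<sigma>. \<tau> \<subseteq> \<sigma>}) (B <+> B') (case_sum h (Suc \<circ> h'))
      (case_sum \<mu> (\<lambda>c. \<mu>' c \<union> \<tau>)) dC (Inl z)"
    using mapping_cone[OF F(1) G(1)] .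
  have card: "card (\<mu>' b \<union> \<tau>) = card (\<mu>' b) + card \<tau>" if "b \<in> B'" for b
    using that G(2) assms(3,4) by (intro card_Un_disjoint) (auto intro: finite_subset)
  show ?thesis
  proof (rule resolvableI[OF C])
    show "case_sum \<mu> (\<lambda>c. \<mu>' c \<union> \<tau>) b \<subseteq> U" if "b \<in> B <+> B'" for b
      using that F(2) G(2) assms(3) by (cases b) fastforce+
    show "(\<lambda>b. (case_sum h (Suc \<circ> h') b, card (case_sum \<mu> (\<lambda>c. \<mu>' c \<union> \<tau>) b))) ` (B <+> B') =
        Q \<union> (\<lambda>(i, j). (Suc i, j + card \<tau>)) ` Q'"
      unfolding Plus_def image_Un image_image F(3)[symmetric] G(3)[symmetric]
      using card by (intro arg_cong2[where f = "(\<union>)"] image_cong) auto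
  qed
qed

context scalar_resolution begin

text \<open>Equal multidegrees make the entry at \<open>(b, c)\<close> a nonzero constant, so
  Gaussian elimination splits off a trivial two-term complex. Properness protects the base element:
  for \<open>b = z\<close>, \<open>augmented\<close> would put the empty support into
  \<open>I\<close>.\<close>

lemma cancel:
  assumes proper: "{} \<notin> I" and bc: "d b c \<noteq> 0" "\<mu> b = \<mu> c"
  obtains d' :: "'b \<Rightarrow> 'b \<Rightarrow> 'k" where "scalar_resolution I (B - {b, c}) h \<mu> d' z"
proof -
  define u where "u = d b c"
  have u: "u \<noteq> 0" using bc by (simp add: u_def)
  define B' where "B' = B - {b, c}"
  have b: "b \<in> B" and c: "c \<in> B" and hc: "h c = Suc (h b)" using supp[OF bc(1)] by auto
  have ne: "b \<noteq> c" "c \<noteq> z" "b \<noteq> z"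
    using hc base bc augmented[of c] proper by auto
  have sum_split: "sum f B = sum f B' + f b + f c" for f :: "'b \<Rightarrow> 'k"
    unfolding B'_def using b c ne fin
    by (subst sum.remove[of B b], simp, simp, subst sum.remove[of "B - {b}" c])
      (auto simp: insert_commute Diff_insert2[symmetric] add.commute add.left_commute)
  \<comment> \<open>The Schur complement of the pivot \<open>u\<close>.\<close>
  define d' where "d' x y = (if x \<in> B' \<and> y \<in> B' then d x y - d x c * d b y / u else 0)" for x y
  have key: "mulv B' d' w x = mulv B d w x - d x b * w b - d x c / u * mulv B d w b"
    if "x \<in> B'" for w x
  proof -
    have "mulv B' d' w x = (\<Sum>y\<in>B'. d x y * w y - d x c / u * (d b y * w y))"
      unfolding mulv_def by (rule sum.cong) (use that in \<open>auto simp: d'_def algebra_simps\<close>)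
    also have "\<dots> = (\<Sum>y\<in>B'. d x y * w y) - d x c / u * (\<Sum>y\<in>B'. d b y * w y)"
      by (simp add: sum_subtractf sum_distrib_left)
    finally show ?thesis
      unfolding mulv_def[of B] sum_split u_def using bc no_loop by (simp add: field_simps)
  qed
  have out: "mulv B' d' w x = 0" if "x \<notin> B'" for w x using that by (simp add: mulv_def d'_def)
  have "scalar_resolution I B' h \<mu> d' z"
  proof
    show "\<sigma> \<in> I \<Longrightarrow> \<sigma> \<subseteq> \<sigma>' \<Longrightarrow> \<sigma>' \<in> I" for \<sigma> \<sigma>' by (rule up)
    show "finite B'" "z \<in> B'" "h z = 0" "\<mu> z = {}" using fin base ne by (auto simp: B'_def)
    show "x = z" if "x \<in> B'" "h x = 0" for x using that base_unique by (auto simp: B'_def)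
  next
    fix x y assume nz: "d' x y \<noteq> 0"
    then have "x \<in> B'" "y \<in> B'" and "d x y \<noteq> 0 \<or> d x c \<noteq> 0 \<and> d b y \<noteq> 0"
      by (auto simp: d'_def split: if_splits)
    then show "x \<in> B' \<and> y \<in> B' \<and> h y = Suc (h x) \<and> \<mu> x \<subseteq> \<mu> y"
      using supp[of x y] supp[of x c] supp[of b y] hc bc(2) by auto
  next
    fix x w
    show "(\<Sum>y\<in>B'. d' x y * d' y w) = 0"
    proof (cases "x \<in> B' \<and> w \<in> B'")
      case True
      define D1 where "D1 y = d x y - d x c * d b y / u" for y
      define D2 where "D2 y = d y w - d y c * d b w / u" for y
      have "(\<Sum>y\<in>B'. d' x y * d' y w) = (\<Sum>y\<in>B'. D1 y * D2 y)"
        by (rule sum.cong) (use True in \<open>auto simp: d'_def D1_def D2_def\<close>)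
      also have "\<dots> = (\<Sum>y\<in>B. D1 y * D2 y)"
        using bc by (simp add: sum_split D1_def D2_def u_def)
      also have "\<dots> = (\<Sum>y\<in>B. d x y * d y w - (d b w / u) * (d x y * d y c)
          - (d x c / u) * (d b y * d y w) + (d x c * d b w / (u * u)) * (d b y * d y c))"
        by (rule sum.cong) (use u in \<open>auto simp: D1_def D2_def field_simps\<close>)
      also have "\<dots> = 0"
        by (simp only: sum.distrib sum_subtractf square flip: sum_distrib_left) simp
      finally show ?thesis .
    qed (auto simp: d'_def)
  next
    fix y assume "d' z y \<noteq> 0"
    then have "d z y \<noteq> 0 \<or> d z c \<noteq> 0 \<and> d b y \<noteq> 0" by (auto simp: d'_def split: if_splits)
    then show "\<mu> y \<in> I" using augmented up supp[of b y] bc(2) by metis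
  next
    fix v \<sigma>
    assume v: "v \<in> strand B' \<mu> \<sigma>" and cyc: "mulv B' d' v = (\<lambda>_. 0)" and aug: "v z = 0 \<or> \<sigma> \<in> I"
    define \<beta> where "\<beta> = mulv B d v b"
    have vbc: "v b = 0" "v c = 0" using v unfolding strand_def B'_def by auto
    have vB: "v \<in> strand B \<mu> \<sigma>" using v unfolding strand_def B'_def by auto
    \<comment> \<open>This multiple of \<open>c\<close> cancels the coordinate of the boundary at
      \<open>b\<close>. The coordinate at \<open>c\<close> then vanishes too, because the
      differential squares to zero and \<open>u\<close> is invertible.\<close>
    define v1 where "v1 x = v x + (if x = c then - \<beta> / u else 0)" for x
    have "\<mu> c \<subseteq> \<sigma>" if "\<beta> \<noteq> 0"
      using that mulv_strand[OF vB] bc(2) unfolding strand_def \<beta>_def by auto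
    then have v1s: "v1 \<in> strand B \<mu> \<sigma>" using vB c vbc unfolding strand_def v1_def by auto
    have dv1: "mulv B d v1 x = mulv B d v x - d x c / u * \<beta>" for x
      unfolding v1_def mulv_add mulv_unit[OF fin c] by simp
    have zero: "mulv B d v1 x = 0" if neq: "x \<noteq> c" for x
    proof -
      consider "x \<in> B'" | "x = b" | "x \<notin> B" using neq unfolding B'_def by blast
      then show ?thesis
      proof cases
        case 1
        then show ?thesis using key[OF 1, of v] fun_cong[OF cyc, of x] vbc
          by (simp add: dv1 \<beta>_def)
      next
        case 2
        then show ?thesis using u by (simp add: dv1 \<beta>_def u_def)
      next
        case 3
        then have "d x y = 0" for y using supp[of x y] by auto
        then show ?thesis by (simp add: mulv_def)
      qed
    qed
    have "mulv B d (mulv B d v1) b = (\<Sum>y\<in>B. if y = c then u * mulv B d v1 c else 0)"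
      unfolding mulv_def[of B d "mulv B d v1"]
      by (rule sum.cong) (auto simp: zero u_def)
    then have "mulv B d v1 c = 0" using u c fin by (simp add: mulv_mulv)
    then have "mulv B d v1 = (\<lambda>_. 0)" using zero by (metis (no_types))
    moreover have "v1 z = 0 \<or> \<sigma> \<in> I" using aug ne by (simp add: v1_def)
    ultimately obtain w where w: "w \<in> strand B \<mu> \<sigma>" "v1 = mulv B d w" using exact[OF v1s] by blast
    define e where "e = mulv B d (\<lambda>x. if x = c then 1 else 0)"
    have e: "e x = d x c" for x unfolding e_def mulv_unit[OF fin c] by simp
    \<comment> \<open>Subtracting a multiple of the boundary of \<open>c\<close> keeps the image and
      clears the coordinate at \<open>b\<close>. With \<open>v1 b = 0\<close>, \<open>key\<close>
      then says that \<open>d\<close> and \<open>d'\<close> agree on \<open>w2\<close> over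
      \<open>B'\<close>.\<close>
    define w2 where "w2 x = w x + (- w b / u) * e x" for x
    have dw2: "mulv B d w2 = v1"
      unfolding w2_def mulv_add mulv_scale e_def mulv_mulv using w(2) by simp
    have w2b: "w2 b = 0" using u by (simp add: w2_def e u_def)
    have w2s: "w2 \<in> strand B \<mu> \<sigma>"
    proof (cases "w b = 0")
      case True
      then have "w2 = w" by (simp add: w2_def fun_eq_iff)
      then show ?thesis using w(1) by simp
    next
      case False
      then have "\<mu> c \<subseteq> \<sigma>" using w(1) bc(2) unfolding strand_def by auto
      then have "e \<in> strand B \<mu> \<sigma>" unfolding e_def using c by (intro mulv_strand unit_strand)
      then show ?thesis using w(1) unfolding strand_def w2_def by (auto, force+)
    qed
    define w3 where "w3 x = (if x \<in> B' then w2 x else 0)" for x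
    have "w3 \<in> strand B' \<mu> \<sigma>" using w2s unfolding strand_def w3_def by auto
    moreover have "v = mulv B' d' w3"
    proof
      fix x
      show "v x = mulv B' d' w3 x"
      proof (cases "x \<in> B'")
        case True
        have "mulv B' d' w3 x = mulv B' d' w2 x"
          unfolding mulv_def by (rule sum.cong) (auto simp: w3_def)
        also have "\<dots> = v x" using True ne vbc unfolding key[OF True] dw2 w2b by (auto simp: v1_def B'_def)
        finally show ?thesis by simp
      next
        case False
        then show ?thesis using v out[OF False] unfolding strand_def by auto
      qed
    qed
    ultimately show "\<exists>w\<in>strand B' \<mu> \<sigma>. v = mulv B' d' w" by blast
  qed
  then show thesis using that unfolding B'_def by blast
qed

end

lemma minimize:
  fixes d :: "'b \<Rightarrow> 'b \<Rightarrow> 'k::field"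
  assumes "scalar_resolution I B h \<mu> d z" and "{} \<notin> I"
    and "\<And>b. b \<in> B \<Longrightarrow> h b \<le> P \<and> card (\<mu> b) \<le> r + h b"
    and "\<exists>b\<in>B. h b = P \<and> card (\<mu> b) = r + P"
  shows "\<exists>B' (d' :: 'b \<Rightarrow> 'b \<Rightarrow> 'k). B' \<subseteq> B \<and> scalar_resolution I B' h \<mu> d' z \<and>
    (\<forall>b c. d' b c \<noteq> 0 \<longrightarrow> \<mu> b \<noteq> \<mu> c) \<and> (\<exists>b\<in>B'. h b = P \<and> card (\<mu> b) = r + P)"
  using assms
proof (induction "card B" arbitrary: B d rule: less_induct)
  case less
  interpret scalar_resolution I B h \<mu> d z by fact
  show ?case
  proof (cases "\<exists>b c. d b c \<noteq> 0 \<and> \<mu> b = \<mu> c")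
    case False
    then show ?thesis using less.prems by blast
  next
    case True
    then obtain b c where bc: "d b c \<noteq> 0" "\<mu> b = \<mu> c" by blast
    have bcB: "b \<in> B" "c \<in> B" "h c = Suc (h b)" using supp[OF bc(1)] by auto
    obtain d' :: "'b \<Rightarrow> 'b \<Rightarrow> 'k" where d': "scalar_resolution I (B - {b, c}) h \<mu> d' z"
      using cancel[OF less.prems(2) bc] .
    have "\<exists>a\<in>B - {b, c}. h a = P \<and> card (\<mu> a) = r + P"
    proof -
      obtain a where a: "a \<in> B" "h a = P" "card (\<mu> a) = r + P" using less.prems(4) by blast
      \<comment> \<open>If the corner were \<open>b\<close>, its partner would have homological
        degree \<open>P + 1\<close>. If it were \<open>c\<close>, its partner would have degree
        \<open>r + P\<close> in homological degree \<open>P - 1\<close>, above the regularity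
        bound.\<close>
      have "a \<noteq> b" using less.prems(3)[OF bcB(2)] a bcB by auto
      moreover have "a \<noteq> c" using less.prems(3)[OF bcB(1)] a bcB bc by auto
      ultimately show ?thesis using a by blast
    qed
    moreover have "card (B - {b, c}) < card B"
      using fin bcB by (intro psubset_card_mono) auto
    ultimately obtain B' and d'' :: "'b \<Rightarrow> 'b \<Rightarrow> 'k" where "B' \<subseteq> B - {b, c}" "scalar_resolution I B' h \<mu> d'' z"
      "\<forall>b c. d'' b c \<noteq> 0 \<longrightarrow> \<mu> b \<noteq> \<mu> c" "\<exists>b\<in>B'. h b = P \<and> card (\<mu> b) = r + P"
      using less.hyps[OF _ d' less.prems(2)] less.prems(3) by blast
    then show ?thesis by blast
  qed
qed

text \<open>The flag allows the same rules for a summand that only has to stay inside the bounds and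
  for one that must occupy the corner.\<close>

definition resolvable_within ::
  "'k::field itself \<Rightarrow> nat set set \<Rightarrow> nat set \<Rightarrow> nat \<Rightarrow> nat \<Rightarrow> bool \<Rightarrow> bool" where
  "resolvable_within K I U P r attained \<longleftrightarrow> (\<exists>Q. resolvable K I U Q \<and>
     (\<forall>(i, j)\<in>Q. i \<le> P \<and> j \<le> r + i) \<and> (attained \<longrightarrow> (P, r + P) \<in> Q))"

lemma resolvable_within_mono:
  assumes "resolvable_within K I U P r c" and "U \<subseteq> U'" "P \<le> P'" "r \<le> r'"
    and "c' \<Longrightarrow> c \<and> P = P' \<and> r = r'"
  shows "resolvable_within K I U' P' r' c'"
proof -
  obtain Q where Q: "resolvable K I U Q" "\<forall>(i, j)\<in>Q. i \<le> P \<and> j \<le> r + i" "c \<longrightarrow> (P, r + P) \<in> Q"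
    using assms(1) unfolding resolvable_within_def by blast
  have "resolvable K I U' Q" using Q(1) assms(2) by (rule resolvable_mono)
  moreover have "i \<le> P' \<and> j \<le> r' + i" if "(i, j) \<in> Q" for i j
    using bspec[OF Q(2) that] assms(3,4) by auto
  ultimately show ?thesis
    using Q(3) assms(5) unfolding resolvable_within_def by (intro exI[of _ Q]) auto
qed

text \<open>The colon part moves by one homological degree and \<open>card \<tau>\<close> internal
  degrees, so its regularity changes by \<open>card \<tau> - 1\<close>; \<open>Suc r''\<close>
  avoids the subtraction. The last hypothesis lists the two summands from which the corner may
  come.\<close>

lemma resolvable_within_cone:
  assumes "resolvable_within TYPE('k::field) J U P r c"
    and "resolvable_within TYPE('k) {\<sigma>. \<sigma> \<union> \<tau> \<in> J} (U - \<tau>) P' r' c'"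
    and "\<tau> \<subseteq> U" "finite U"
    and "P \<le> P''" "r \<le> r''" "Suc P' \<le> P''" "r' + card \<tau> \<le> Suc r''"
    and "c'' \<Longrightarrow> c \<and> P = P'' \<and> r = r'' \<or> c' \<and> P'' = Suc P' \<and> Suc r'' = r' + card \<tau>"
  shows "resolvable_within TYPE('k) (J \<union> {\<sigma>. \<tau> \<subseteq> \<sigma>}) U P'' r'' c''"
proof -
  obtain Q where Q: "resolvable TYPE('k) J U Q" "\<forall>(i, j)\<in>Q. i \<le> P \<and> j \<le> r + i" "c \<longrightarrow> (P, r + P) \<in> Q"
    using assms(1) unfolding resolvable_within_def by blast
  obtain Q' where Q': "resolvable TYPE('k) {\<sigma>. \<sigma> \<union> \<tau> \<in> J} (U - \<tau>) Q'"
    "\<forall>(i, j)\<in>Q'. i \<le> P' \<and> j \<le> r' + i" "c' \<longrightarrow> (P', r' + P') \<in> Q'"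
    using assms(2) unfolding resolvable_within_def by blast
  define Q'' where "Q'' = Q \<union> (\<lambda>(i, j). (Suc i, j + card \<tau>)) ` Q'"
  have "resolvable TYPE('k) (J \<union> {\<sigma>. \<tau> \<subseteq> \<sigma>}) U Q''"
    unfolding Q''_def using Q(1) Q'(1) assms(3,4) by (rule resolvable_cone)
  moreover have "i \<le> P'' \<and> j \<le> r'' + i" if "(i, j) \<in> Q''" for i j
  proof -
    consider "(i, j) \<in> Q" | i' j' where "(i', j') \<in> Q'" "i = Suc i'" "j = j' + card \<tau>"
      using \<open>(i, j) \<in> Q''\<close> unfolding Q''_def by auto
    then show ?thesis
    proof cases
      case 1
      then show ?thesis using bspec[OF Q(2) 1] assms(5,6) by auto
    next
      case 2
      then show ?thesis using bspec[OF Q'(2) 2(1)] assms(7,8) by auto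
    qed
  qed
  moreover have "(P'', r'' + P'') \<in> Q''" if c''
    using assms(9)[OF that]
  proof (elim disjE conjE)
    assume "c'" "P'' = Suc P'" "Suc r'' = r' + card \<tau>"
    then have "(P'', r'' + P'') = (\<lambda>(i, j). (Suc i, j + card \<tau>)) (P', r' + P')" by simp
    then show ?thesis unfolding Q''_def using Q'(3) \<open>c'\<close> by blast
  qed (use Q(3) Q''_def in auto)
  ultimately show ?thesis unfolding resolvable_within_def by (intro exI[of _ Q'']) auto
qed

section \<open>Path ideals of lines and cycles\<close>

text \<open>The line has the vertices \<open>a + 1, \<dots>, a + m\<close>. For \<open>s = t\<close> the initial segment is itself a path.\<close>

definition line_ideal :: "nat \<Rightarrow> nat \<Rightarrow> nat \<Rightarrow> nat \<Rightarrow> nat set set" where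
  "line_ideal t a m s =
     {\<sigma>. (s \<le> m \<and> {a<..a+s} \<subseteq> \<sigma>) \<or> (\<exists>i. a \<le> i \<and> i + t \<le> a + m \<and> {i<..i+t} \<subseteq> \<sigma>)}"

lemma line_idealI_segment: "s \<le> m \<Longrightarrow> {a<..a+s} \<subseteq> \<sigma> \<Longrightarrow> \<sigma> \<in> line_ideal t a m s"
  by (simp add: line_ideal_def)

lemma line_idealI_path:
  "a \<le> i \<Longrightarrow> i + t \<le> a + m \<Longrightarrow> {i<..i+t} \<subseteq> \<sigma> \<Longrightarrow> \<sigma> \<in> line_ideal t a m s"
  by (auto simp: line_ideal_def)

lemma line_idealE:
  assumes "\<sigma> \<in> line_ideal t a m s"
  obtains "s \<le> m" "{a<..a+s} \<subseteq> \<sigma>" | i where "a \<le> i" "i + t \<le> a + m" "{i<..i+t} \<subseteq> \<sigma>"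
  using assms unfolding line_ideal_def mem_Collect_eq by (elim disjE exE conjE)

lemma line_idealE_path:
  assumes "\<sigma> \<in> line_ideal t a m t"
  obtains i where "a \<le> i" "i + t \<le> a + m" "{i<..i+t} \<subseteq> \<sigma>"
  using assms by (rule line_idealE) (use that[of a] that in simp_all)

text \<open>The path from the first vertex contains the segment and is redundant; every other path
  lies in the line without that vertex.\<close>

lemma line_ideal_step:
  assumes "1 \<le> s" "s \<le> t" "s \<le> m"
  shows "line_ideal t a m s = line_ideal t (Suc a) (m - 1) t \<union> {\<sigma>. {a<..a+s} \<subseteq> \<sigma>}"
proof (intro equalityI subsetI)
  fix \<sigma> assume "\<sigma> \<in> line_ideal t a m s"
  then show "\<sigma> \<in> line_ideal t (Suc a) (m - 1) t \<union> {\<sigma>. {a<..a+s} \<subseteq> \<sigma>}"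
  proof (cases rule: line_idealE)
    case (2 i)
    show ?thesis
    proof (cases "i = a")
      case True
      then have "{a<..a+s} \<subseteq> {i<..i+t}" using assms by auto
      then show ?thesis using 2(3) by blast
    next
      case False
      then have "Suc a \<le> i" "i + t \<le> Suc a + (m - 1)" using 2 assms by auto
      then show ?thesis using 2(3) by (intro UnI1 line_idealI_path)
    qed
  qed blast
next
  fix \<sigma> assume "\<sigma> \<in> line_ideal t (Suc a) (m - 1) t \<union> {\<sigma>. {a<..a+s} \<subseteq> \<sigma>}"
  then show "\<sigma> \<in> line_ideal t a m s"
  proof
    assume "\<sigma> \<in> line_ideal t (Suc a) (m - 1) t"
    then obtain i where i: "Suc a \<le> i" "i + t \<le> Suc a + (m - 1)" "{i<..i+t} \<subseteq> \<sigma>"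
      by (rule line_idealE_path)
    then have "a \<le> i" "i + t \<le> a + m" using assms by auto
    then show ?thesis using i(3) by (rule line_idealI_path)
  next
    assume "\<sigma> \<in> {\<sigma>. {a<..a+s} \<subseteq> \<sigma>}"
    then show ?thesis using assms(3) by (intro line_idealI_segment) simp_all
  qed
qed

text \<open>Outside the segment, the path from the second vertex leaves its last
  \<open>t + 1 - s\<close> vertices, an initial segment of the remaining line. Later paths that meet
  the segment leave more, and those disjoint from it are unchanged.\<close>

lemma line_ideal_colon:
  assumes "1 \<le> s" "s \<le> t" "s \<le> m"
  shows "{\<sigma>. \<sigma> \<union> {a<..a+s} \<in> line_ideal t (Suc a) (m - 1) t} = line_ideal t (a + s) (m - s) (t + 1 - s)"
    (is "?L = ?R")
proof (intro equalityI subsetI)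
  fix \<sigma> assume "\<sigma> \<in> ?L"
  then have "\<sigma> \<union> {a<..a+s} \<in> line_ideal t (Suc a) (m - 1) t" by simp
  then obtain i where "Suc a \<le> i" "i + t \<le> Suc a + (m - 1)" "{i<..i+t} \<subseteq> \<sigma> \<union> {a<..a+s}"
    by (rule line_idealE_path)
  then have i: "Suc a \<le> i" "i + t \<le> a + m" "{i<..i+t} \<subseteq> \<sigma> \<union> {a<..a+s}" using assms by auto
  show "\<sigma> \<in> ?R"
  proof (cases "a + s \<le> i")
    case True
    then have "{i<..i+t} \<inter> {a<..a+s} = {}" by auto
    then have "{i<..i+t} \<subseteq> \<sigma>" using i(3) by blast
    then show ?thesis using True i(2) assms by (intro line_idealI_path[of _ i]) auto
  next
    case False
    have "{a+s<..a+s+(t+1-s)} \<subseteq> \<sigma>"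
    proof
      fix x assume "x \<in> {a+s<..a+s+(t+1-s)}"
      then have "x \<in> {i<..i+t}" "x \<notin> {a<..a+s}" using False i(1) assms by auto
      then show "x \<in> \<sigma>" using i(3) by blast
    qed
    then show ?thesis using i(1,2) assms by (intro line_idealI_segment) auto
  qed
next
  fix \<sigma> assume "\<sigma> \<in> ?R"
  then have "\<sigma> \<union> {a<..a+s} \<in> line_ideal t (Suc a) (m - 1) t"
  proof (cases rule: line_idealE)
    case 1
    have "{Suc a<..Suc a+t} \<subseteq> {a<..a+s} \<union> {a+s<..a+s+(t+1-s)}" using assms by auto
    then have "{Suc a<..Suc a+t} \<subseteq> \<sigma> \<union> {a<..a+s}" using 1(2) by blast
    moreover have "t \<le> m - 1" using 1(1) assms by auto
    ultimately show ?thesis by (intro line_idealI_segment)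
  next
    case (2 i)
    then have "Suc a \<le> i" "i + t \<le> Suc a + (m - 1)" using assms by auto
    then show ?thesis using 2(3) by (intro line_idealI_path) auto
  qed
  then show "\<sigma> \<in> ?L" by simp
qed

text \<open>Whenever the segment fits, the corner comes from the colon ideal; the line without its
  first vertex only has to stay within the bounds.\<close>

lemma line_ideal_resolvable:
  assumes "1 \<le> s" "s \<le> t" "m = (t + 1) * q + e" "e \<le> t"
  shows "resolvable_within TYPE('k::field) (line_ideal t a m s) {a<..a+m}
    (if e < s then 2 * q else 2 * q + 1) ((t - 1) * q + (if e < s then 0 else s - 1)) True"
  using assms
proof (induction m arbitrary: a s q e rule: less_induct)
  case (less m)
  show ?case
  proof (cases "s \<le> m")
    case False
    then have "q = 0" using less.prems by (cases q) auto
    moreover have "line_ideal t a m s = {}"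
      unfolding line_ideal_def using False less.prems by auto
    ultimately show ?thesis
      using less.prems False resolvable_empty[of "{a<..a+m}", where 'k = 'k]
      unfolding resolvable_within_def by (auto intro!: exI[of _ "{(0, 0)}"])
  next
    case True
    obtain t' where t': "t = Suc t'" using less.prems by (cases t) auto
    let ?\<tau> = "{a<..a+s}"
    let ?P = "if e < s then 2 * q else 2 * q + 1"
    let ?R = "(t - 1) * q + (if e < s then 0 else s - 1)"
    \<comment> \<open>Dropping a vertex lowers the remainder by one, or breaks up a block of
      \<open>t + 1\<close> if \<open>e = 0\<close>.\<close>
    have "\<exists>q' e'. m - 1 = (t + 1) * q' + e' \<and> e' \<le> t \<and>
        (if e' < t then 2 * q' else 2 * q' + 1) \<le> ?P \<and>
        (t - 1) * q' + (if e' < t then 0 else t - 1) \<le> ?R"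
    proof (cases e)
      case 0
      then obtain q' where "q = Suc q'" using less.prems True by (cases q) auto
      then show ?thesis using 0 less.prems t' by (intro exI[of _ q'] exI[of _ t]) auto
    next
      case (Suc e')
      then show ?thesis using less.prems by (intro exI[of _ q] exI[of _ e']) auto
    qed
    then obtain q' e' where F: "m - 1 = (t + 1) * q' + e'" "e' \<le> t"
      "(if e' < t then 2 * q' else 2 * q' + 1) \<le> ?P"
      "(t - 1) * q' + (if e' < t then 0 else t - 1) \<le> ?R" by blast
    have "resolvable_within TYPE('k) (line_ideal t (Suc a) (m - 1) t) {Suc a<..Suc a+(m-1)}
        (if e' < t then 2 * q' else 2 * q' + 1) ((t - 1) * q' + (if e' < t then 0 else t - 1)) True"
      using less.prems True F(1,2) by (intro less.IH) auto
    then have FR: "resolvable_within TYPE('k) (line_ideal t (Suc a) (m - 1) t) {a<..a+m} ?P ?R False"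
      using F(3,4) True less.prems by (elim resolvable_within_mono) auto
    \<comment> \<open>The two cases alternate: for \<open>e \<ge> s\<close> the new remainder
      \<open>e - s\<close> is below the new threshold \<open>t + 1 - s\<close>; for
      \<open>e < s\<close> a block is broken up and the remainder \<open>t + 1 + e - s\<close>
      reaches it.\<close>
    have "\<exists>q' e'. m - s = (t + 1) * q' + e' \<and> e' \<le> t \<and>
        Suc (if e' < t + 1 - s then 2 * q' else 2 * q' + 1) = ?P \<and>
        (t - 1) * q' + (if e' < t + 1 - s then 0 else t + 1 - s - 1) + s = Suc ?R"
    proof (cases "e < s")
      case False
      then show ?thesis using less.prems by (intro exI[of _ q] exI[of _ "e - s"]) auto
    next
      case e: True
      then obtain q' where "q = Suc q'" using less.prems True by (cases q) auto
      then show ?thesis using e less.prems t' by (intro exI[of _ q'] exI[of _ "t + 1 + e - s"]) auto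
    qed
    then obtain q' e' where G: "m - s = (t + 1) * q' + e'" "e' \<le> t"
      "Suc (if e' < t + 1 - s then 2 * q' else 2 * q' + 1) = ?P"
      "(t - 1) * q' + (if e' < t + 1 - s then 0 else t + 1 - s - 1) + s = Suc ?R" by blast
    have "resolvable_within TYPE('k) (line_ideal t (a + s) (m - s) (t + 1 - s)) {a+s<..a+s+(m-s)}
       (if e' < t + 1 - s then 2 * q' else 2 * q' + 1)
       ((t - 1) * q' + (if e' < t + 1 - s then 0 else t + 1 - s - 1)) True"
      using less.prems True G(1,2) by (intro less.IH) auto
    moreover have "{a<..a+m} - ?\<tau> = {a+s<..a+s+(m-s)}" using True by auto
    ultimately have "resolvable_within TYPE('k) {\<sigma>. \<sigma> \<union> ?\<tau> \<in> line_ideal t (Suc a) (m - 1) t}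
        ({a<..a+m} - ?\<tau>) (if e' < t + 1 - s then 2 * q' else 2 * q' + 1)
       ((t - 1) * q' + (if e' < t + 1 - s then 0 else t + 1 - s - 1)) True"
      using line_ideal_colon[OF less.prems(1,2) True] by simp
    then show ?thesis
      unfolding line_ideal_step[OF less.prems(1,2) True]
      using FR G(3,4) True
      by (intro resolvable_within_cone[where c = False and c' = True]) auto
  qed
qed

section \<open>Adding the paths through the edge from n to 1\<close>

definition wrapped_path :: "nat \<Rightarrow> nat \<Rightarrow> nat \<Rightarrow> nat set" where
  "wrapped_path n t k = {n-t+k<..n} \<union> {0<..k}"

text \<open>The paths avoiding the edge from \<open>n\<close> to \<open>1\<close>, and the first \<open>k\<close> of the paths through it.\<close>

definition cycle_ideal :: "nat \<Rightarrow> nat \<Rightarrow> nat \<Rightarrow> nat set set" where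
  "cycle_ideal n t k = line_ideal t 0 n t \<union> {\<sigma>. \<exists>j. 1 \<le> j \<and> j \<le> k \<and> wrapped_path n t j \<subseteq> \<sigma>}"

lemma cycle_ideal_Suc:
  "cycle_ideal n t (Suc k) = cycle_ideal n t k \<union> {\<sigma>. wrapped_path n t (Suc k) \<subseteq> \<sigma>}"
  unfolding cycle_ideal_def by (auto simp: le_Suc_eq)

text \<open>Let \<open>v = n - t + Suc k\<close>, the vertex just before the new path. The earlier
  wrapped paths and the straight paths that reach \<open>v\<close> all contain it, and one of them
  leaves nothing else. The other straight paths leave a line strictly between \<open>Suc k\<close>
  and \<open>v\<close>; its initial segment of \<open>t - Suc k\<close> vertices is what the path
  from vertex 1 leaves.\<close>

lemma cycle_ideal_colon:
  assumes "Suc k < t" "t < n"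
  shows "{\<sigma>. \<sigma> \<union> wrapped_path n t (Suc k) \<in> cycle_ideal n t k} =
    line_ideal t (Suc k) (n - t - 1) (t - Suc k) \<union> {\<sigma>. {n - t + Suc k} \<subseteq> \<sigma>}" (is "?L = ?R")
proof (intro equalityI subsetI)
  define v where "v = n - t + Suc k"
  have v: "v \<notin> wrapped_path n t (Suc k)" using assms by (auto simp: v_def wrapped_path_def)
  fix \<sigma> assume "\<sigma> \<in> ?L"
  then consider "\<sigma> \<union> wrapped_path n t (Suc k) \<in> line_ideal t 0 n t"
    | j where "1 \<le> j" "j \<le> k" "wrapped_path n t j \<subseteq> \<sigma> \<union> wrapped_path n t (Suc k)"
    unfolding cycle_ideal_def by blast
  then show "\<sigma> \<in> ?R"
  proof cases
    case 1
    then obtain i where i: "i + t \<le> n" "{i<..i+t} \<subseteq> \<sigma> \<union> wrapped_path n t (Suc k)"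
      by (rule line_idealE_path) simp
    show ?thesis
    proof (cases "v \<le> i + t")
      case True
      then have "v \<in> {i<..i+t}" using i(1) assms by (auto simp: v_def)
      then show ?thesis using i(2) v by (auto simp: v_def)
    next
      case False
      have disj: "x \<in> \<sigma>" if "i < x" "x \<le> i + t" "Suc k < x" for x
      proof -
        have "x \<notin> wrapped_path n t (Suc k)" using that False by (auto simp: wrapped_path_def v_def)
        then show ?thesis using i(2) that by auto
      qed
      have "\<sigma> \<in> line_ideal t (Suc k) (n - t - 1) (t - Suc k)"
      proof (cases "Suc k \<le> i")
        case True
        show ?thesis
          by (rule line_idealI_path[of _ i]) (use True False disj assms in \<open>auto simp: v_def\<close>)
      next
        case less: False
        show ?thesis
          by (rule line_idealI_segment) (use less False disj assms in \<open>auto simp: v_def\<close>)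
      qed
      then show ?thesis by blast
    qed
  next
    case 2
    then have "v \<in> wrapped_path n t j" using assms by (auto simp: v_def wrapped_path_def)
    then show ?thesis using 2(3) v by (auto simp: v_def)
  qed
next
  fix \<sigma> assume "\<sigma> \<in> ?R"
  then have "\<sigma> \<union> wrapped_path n t (Suc k) \<in> cycle_ideal n t k"
  proof
    assume "\<sigma> \<in> line_ideal t (Suc k) (n - t - 1) (t - Suc k)"
    then have "\<sigma> \<union> wrapped_path n t (Suc k) \<in> line_ideal t 0 n t"
    proof (cases rule: line_idealE)
      case 1
      have "{0<..0+t} \<subseteq> {Suc k<..Suc k + (t - Suc k)} \<union> wrapped_path n t (Suc k)"
        using assms by (auto simp: wrapped_path_def)
      then have "{0<..0+t} \<subseteq> \<sigma> \<union> wrapped_path n t (Suc k)" using 1(2) by blast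
      then show ?thesis using assms by (intro line_idealI_segment) auto
    next
      case (2 i)
      then show ?thesis using assms by (intro line_idealI_path[of _ i]) auto
    qed
    then show ?thesis unfolding cycle_ideal_def by blast
  next
    assume "\<sigma> \<in> {\<sigma>. {n - t + Suc k} \<subseteq> \<sigma>}"
    then have mem: "n - t + Suc k \<in> \<sigma>" by simp
    have sub: "{n - t + k<..n} \<subseteq> {n - t + Suc k} \<union> {n - t + Suc k<..n}" by auto
    show ?thesis
    \<comment> \<open>For \<open>k = 0\<close> no wrapped path precedes the new one, and the
      straight path ending at \<open>n\<close> takes over its role.\<close>
    proof (cases "k = 0")
      case True
      have "{n - t<..n - t + t} \<subseteq> \<sigma> \<union> wrapped_path n t (Suc k)"
        using sub True assms mem by (auto simp: wrapped_path_def)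
      then have "\<sigma> \<union> wrapped_path n t (Suc k) \<in> line_ideal t 0 n t"
        using assms by (intro line_idealI_path[of _ "n - t"]) auto
      then show ?thesis unfolding cycle_ideal_def by blast
    next
      case False
      have "wrapped_path n t k \<subseteq> \<sigma> \<union> wrapped_path n t (Suc k)"
        using sub mem by (auto simp: wrapped_path_def)
      then show ?thesis using False unfolding cycle_ideal_def by (auto intro!: exI[of _ k])
    qed
  qed
  then show "\<sigma> \<in> ?L" by simp
qed

lemma card_wrapped_path: "k \<le> t \<Longrightarrow> t \<le> n \<Longrightarrow> card (wrapped_path n t k) = t"
  unfolding wrapped_path_def by (subst card_Un_disjoint) auto

lemma line_ideal_colon_outside:
  assumes "v \<notin> {a<..a+m}"
  shows "{\<sigma>. \<sigma> \<union> {v} \<in> line_ideal t a m s} = line_ideal t a m s"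
proof (intro equalityI subsetI)
  fix \<sigma> assume "\<sigma> \<in> {\<sigma>. \<sigma> \<union> {v} \<in> line_ideal t a m s}"
  then have "\<sigma> \<union> {v} \<in> line_ideal t a m s" by simp
  then show "\<sigma> \<in> line_ideal t a m s"
  proof (cases rule: line_idealE)
    case 1
    have "v \<notin> {a<..a+s}" using 1 assms by auto
    then show ?thesis using 1 by (intro line_idealI_segment) auto
  next
    case (2 i)
    have "v \<notin> {i<..i+t}" using 2 assms by auto
    then show ?thesis using 2 by (intro line_idealI_path[of _ i]) auto
  qed
qed (auto elim!: line_idealE intro: line_idealI_segment line_idealI_path)

text \<open>For \<open>d = 0\<close> and \<open>d = t\<close> the straight paths alone occupy the
  corner; otherwise the wrapped path with \<open>t - Suc k = d\<close> creates it, and later ones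
  stay within the bounds. Truncated subtraction turns \<open>d - 1\<close> into 0 for
  \<open>d = 0\<close>, which unites both cases of the regularity.\<close>

lemma cycle_ideal_resolvable:
  fixes n t p d :: nat
  assumes n: "n = (t + 1) * Suc p + d" and d: "d \<le> t" and t: "2 \<le> t"
  shows "k < t \<Longrightarrow> resolvable_within TYPE('k::field) (cycle_ideal n t k) {0<..n}
    (if d = 0 then 2 * Suc p else 2 * Suc p + 1) ((t - 1) * Suc p + (d - 1)) (d = 0 \<or> t - k \<le> d)"
    (is "_ \<Longrightarrow> resolvable_within _ _ _ ?P ?R _")
proof (induction k)
  case 0
  have "resolvable_within TYPE('k) (line_ideal t 0 n t) {0<..0+n}
    (if d < t then 2 * Suc p else 2 * Suc p + 1) ((t - 1) * Suc p + (if d < t then 0 else t - 1)) True"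
    using assms by (intro line_ideal_resolvable) auto
  moreover have "cycle_ideal n t 0 = line_ideal t 0 n t" unfolding cycle_ideal_def by auto
  ultimately show ?case
    using d t by (elim resolvable_within_mono[where c = True, OF back_subst[of "\<lambda>I. resolvable_within _ I _ _ _ _"]]) auto
next
  case (Suc k)
  define s where "s = t - Suc k"
  define m where "m = n - t - 1"
  define v where "v = n - t + Suc k"
  have s: "1 \<le> s" "s < t" using Suc.prems by (auto simp: s_def)
  have m: "m = (t + 1) * p + d" using n by (simp add: m_def)
  have tn: "t < n" using n by simp
  have v: "v = Suc k + m + 1" using tn by (simp add: v_def m_def)
  let ?pd = "if d < s then 2 * p else 2 * p + 1"
  let ?reg = "(t - 1) * p + (if d < s then 0 else s - 1)"
  let ?A = "line_ideal t (Suc k) m s"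
  have A: "resolvable_within TYPE('k) ?A {Suc k<..Suc k + m} ?pd ?reg True"
    using s m d by (intro line_ideal_resolvable) auto
  \<comment> \<open>The variable \<open>v\<close> lies off the line, so the colon ideal by it is
    \<open>?A\<close> itself: the cone adds one to the homological degree and nothing to the
    regularity.\<close>
  have "resolvable_within TYPE('k) (?A \<union> {\<sigma>. {v} \<subseteq> \<sigma>}) {Suc k<..v} (Suc ?pd) ?reg True"
  proof (rule resolvable_within_cone)
    show "resolvable_within TYPE('k) ?A {Suc k<..v} ?pd ?reg False"
      using A by (rule resolvable_within_mono) (auto simp: v)
    have "v \<notin> {Suc k<..Suc k + m}" by (simp add: v)
    then show "resolvable_within TYPE('k) {\<sigma>. \<sigma> \<union> {v} \<in> ?A} ({Suc k<..v} - {v}) ?pd ?reg True"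
      unfolding line_ideal_colon_outside[OF \<open>v \<notin> _\<close>]
      using A by (elim resolvable_within_mono) (auto simp: v)
  qed (auto simp: v)
  moreover have "{0<..n} - wrapped_path n t (Suc k) = {Suc k<..v}"
    using Suc.prems tn by (auto simp: wrapped_path_def v_def)
  ultimately have G: "resolvable_within TYPE('k) {\<sigma>. \<sigma> \<union> wrapped_path n t (Suc k) \<in> cycle_ideal n t k}
      ({0<..n} - wrapped_path n t (Suc k)) (Suc ?pd) ?reg True"
    unfolding cycle_ideal_colon[OF Suc.prems tn] by (simp only: s_def m_def v_def)
  have F: "resolvable_within TYPE('k) (cycle_ideal n t k) {0<..n} ?P ?R (d = 0 \<or> t - k \<le> d)"
    using Suc by simp
  show ?case
    unfolding cycle_ideal_Suc
  proof (rule resolvable_within_cone[OF F G])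
    show "wrapped_path n t (Suc k) \<subseteq> {0<..n}" using Suc.prems tn by (auto simp: wrapped_path_def)
    have c: "card (wrapped_path n t (Suc k)) = t" using Suc.prems tn by (intro card_wrapped_path) auto
    show "Suc (Suc ?pd) \<le> ?P" using s by auto
    show "?reg + card (wrapped_path n t (Suc k)) \<le> Suc ?R" using c s by auto
    assume "d = 0 \<or> t - Suc k \<le> d"
    \<comment> \<open>Either the corner is inherited from the earlier paths, or the present path
      creates it.\<close>
    then consider "d = 0 \<or> t - k \<le> d" | "d = s" unfolding s_def by linarith
    then show "(d = 0 \<or> t - k \<le> d) \<and> ?P = ?P \<and> ?R = ?R \<or>
        True \<and> ?P = Suc (Suc ?pd) \<and> Suc ?R = ?reg + card (wrapped_path n t (Suc k))"
      using c s by cases auto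
  qed auto
qed

section \<open>From scalars to polynomials\<close>

lemma lookup_single_mult_add:
  fixes p :: "'k::field mpoly"
  shows "Poly_Mapping.lookup (Poly_Mapping.single k u * p) (k + l) = u * Poly_Mapping.lookup p l"
proof -
  have "Poly_Mapping.lookup (Poly_Mapping.single k u * p) (k + l) =
      Sum_any (\<lambda>x. u * Sum_any (\<lambda>q. Poly_Mapping.lookup p q when k + l = x + q) when k = x)"
    by (simp add: lookup_mult lookup_single when_mult)
  also have "\<dots> = u * Poly_Mapping.lookup p l" by simp
  finally show ?thesis .
qed

lemma lookup_single_mult_not:
  fixes p :: "'k::field mpoly"
  assumes "\<And>l. m \<noteq> k + l"
  shows "Poly_Mapping.lookup (Poly_Mapping.single k u * p) m = 0"
proof (rule ccontr)
  assume "\<not> ?thesis"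
  then have "m \<in> Poly_Mapping.keys (Poly_Mapping.single k u * p)" by (simp add: in_keys_iff)
  then show False using keys_mult[of "Poly_Mapping.single k u" p] assms by (auto split: if_splits)
qed

definition chi :: "nat set \<Rightarrow> nat \<Rightarrow>\<^sub>0 nat" where
  "chi \<sigma> = (\<Sum>i\<in>\<sigma>. Poly_Mapping.single i 1)"

lemma lookup_chi: "finite \<sigma> \<Longrightarrow> Poly_Mapping.lookup (chi \<sigma>) i = (if i \<in> \<sigma> then 1 else 0)"
  by (simp add: chi_def lookup_sum lookup_single when_def)

lemma keys_chi: "finite \<sigma> \<Longrightarrow> Poly_Mapping.keys (chi \<sigma>) = \<sigma>"
  by (auto simp: in_keys_iff lookup_chi split: if_splits)

lemma degree_chi: "finite \<sigma> \<Longrightarrow> monomial_degree (chi \<sigma>) = card \<sigma>"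
  by (simp add: monomial_degree_def keys_chi lookup_chi)

lemma chi_empty [simp]: "chi {} = 0" by (simp add: chi_def)

lemma chi_split:
  assumes "finite \<tau>" "\<sigma> \<subseteq> \<tau>" shows "chi \<tau> = chi \<sigma> + chi (\<tau> - \<sigma>)"
  using assms finite_subset[OF assms(2,1)]
  by (intro poly_mapping_eqI) (auto simp: lookup_add lookup_chi)

lemma chi_minus:
  assumes "finite \<sigma>" "\<sigma> \<subseteq> Poly_Mapping.keys m" shows "chi \<sigma> + (m - chi \<sigma>) = m"
proof (rule poly_mapping_eqI)
  fix i
  have "1 \<le> Poly_Mapping.lookup m i" if "i \<in> \<sigma>"
    using that assms(2) by (metis in_keys_iff less_one not_less subsetD)
  then show "Poly_Mapping.lookup (chi \<sigma> + (m - chi \<sigma>)) i = Poly_Mapping.lookup m i"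
    using assms(1) by (auto simp: lookup_add lookup_minus lookup_chi)
qed

lemma keys_minus_nat: "Poly_Mapping.keys (m - k :: nat \<Rightarrow>\<^sub>0 nat) \<subseteq> Poly_Mapping.keys m"
  by (auto simp: in_keys_iff lookup_minus)

lemma polys_zero [simp]: "0 \<in> polys n" by (simp add: polys_def)

lemma polys_add: "f \<in> polys n \<Longrightarrow> g \<in> polys n \<Longrightarrow> f + g \<in> polys n"
  unfolding polys_def using keys_add[of f g] by blast

lemma polys_sum: "(\<And>x. x \<in> A \<Longrightarrow> f x \<in> polys n) \<Longrightarrow> sum f A \<in> polys n"
  by (induction A rule: infinite_finite_induct) (auto intro: polys_add)

lemma polys_minus: "f \<in> polys n \<Longrightarrow> g \<in> polys n \<Longrightarrow> f - g \<in> polys n"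
  using polys_add[of f n "- g"] unfolding polys_def by (auto simp: in_keys_iff)

lemma polys_mult: "f \<in> polys n \<Longrightarrow> g \<in> polys n \<Longrightarrow> f * g \<in> polys n"
  unfolding polys_def
proof safe
  fix m x
  assume fg: "\<forall>m\<in>Poly_Mapping.keys f. Poly_Mapping.keys m \<subseteq> {1..n}"
    "\<forall>m\<in>Poly_Mapping.keys g. Poly_Mapping.keys m \<subseteq> {1..n}"
    and "m \<in> Poly_Mapping.keys (f * g)" and x: "x \<in> Poly_Mapping.keys m"
  then obtain a b where "m = a + b" "a \<in> Poly_Mapping.keys f" "b \<in> Poly_Mapping.keys g"
    using keys_mult by blast
  then show "x \<in> {1..n}" using keys_add[of a b] fg x by blast
qed

lemma polys_single: "Poly_Mapping.keys m \<subseteq> {1..n} \<Longrightarrow> Poly_Mapping.single m u \<in> polys n"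
  by (simp add: polys_def)

text \<open>Membership is decided monomial by monomial, which matches the strands;
  \<open>ideal_gen_monomials\<close> supplies the link to generators.\<close>

definition squarefree_ideal :: "nat \<Rightarrow> nat set set \<Rightarrow> 'k::field mpoly set" where
  "squarefree_ideal n I = {f \<in> polys n. \<forall>m\<in>Poly_Mapping.keys f. Poly_Mapping.keys m \<in> I}"

locale polynomial_resolution = scalar_resolution I B h \<mu> d z
  for I :: "nat set set" and B :: "'b set" and h :: "'b \<Rightarrow> nat" and \<mu> :: "'b \<Rightarrow> nat set"
    and d :: "'b \<Rightarrow> 'b \<Rightarrow> 'k::field" and z :: 'b +
  fixes n :: nat
  assumes bounded: "b \<in> B \<Longrightarrow> \<mu> b \<subseteq> {1..n}"
begin

lemma finite_\<mu>: "b \<in> B \<Longrightarrow> finite (\<mu> b)"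
  using bounded finite_subset by blast

definition mon :: "'b \<Rightarrow> 'b \<Rightarrow> 'k mpoly" where
  "mon x y = Poly_Mapping.single (chi (\<mu> y - \<mu> x)) (d x y)"

definition pmap :: "('b \<Rightarrow> 'k mpoly) \<Rightarrow> 'b \<Rightarrow> 'k mpoly" where
  "pmap V x = (\<Sum>y\<in>B. mon x y * V y)"

text \<open>The component of multidegree \<open>m\<close>; the generator \<open>b\<close> has multidegree \<open>chi (\<mu> b)\<close>.\<close>

definition part :: "(nat \<Rightarrow>\<^sub>0 nat) \<Rightarrow> ('b \<Rightarrow> 'k mpoly) \<Rightarrow> 'b \<Rightarrow> 'k" where
  "part m V b = (if b \<in> B \<and> \<mu> b \<subseteq> Poly_Mapping.keys m
     then Poly_Mapping.lookup (V b) (m - chi (\<mu> b)) else 0)"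

lemma mon_nonzero: "mon x y \<noteq> 0 \<Longrightarrow> x \<in> B \<and> y \<in> B \<and> h y = Suc (h x) \<and> \<mu> x \<subseteq> \<mu> y"
  using supp[of x y] by (cases "d x y = 0") (auto simp: mon_def)

lemma mon_polys: "mon x y \<in> polys n"
proof (cases "d x y = 0")
  case False
  then have "\<mu> y \<subseteq> {1..n}" "finite (\<mu> y)" using supp[of x y] bounded finite_\<mu> by auto
  then show ?thesis unfolding mon_def by (intro polys_single) (auto simp: keys_chi)
qed (simp add: mon_def)

lemma part_strand: "part m V \<in> strand B \<mu> (Poly_Mapping.keys m)"
  by (simp add: strand_def part_def)

lemma part_eqI:
  assumes "\<And>m. part m V = part m W" and "\<And>b. b \<notin> B \<Longrightarrow> V b = W b"
  shows "V = W"
proof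
  fix b
  show "V b = W b"
  proof (cases "b \<in> B")
    case True
    show ?thesis
    proof (rule poly_mapping_eqI)
      fix l
      have "\<mu> b \<subseteq> Poly_Mapping.keys (chi (\<mu> b) + l)"
        using finite_\<mu>[OF True] by (auto simp: in_keys_iff lookup_add lookup_chi)
      then show "Poly_Mapping.lookup (V b) l = Poly_Mapping.lookup (W b) l"
        using fun_cong[OF assms(1)[of "chi (\<mu> b) + l"], of b] True by (simp add: part_def)
    qed
  qed (rule assms(2))
qed

text \<open>The bridge between polynomials and scalars. In multidegree \<open>m\<close> each
  coordinate has one relevant coefficient, and the monomial of \<open>mon x y\<close> moves the
  exponent \<open>m - chi (\<mu> y)\<close> to \<open>m - chi (\<mu> x)\<close>; only the scalar
  \<open>d x y\<close> remains.\<close>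

lemma part_pmap: "part m (pmap V) = mulv B d (part m V)"
proof
  fix x
  consider "x \<notin> B" | "x \<in> B" "\<not> \<mu> x \<subseteq> Poly_Mapping.keys m" | "x \<in> B" "\<mu> x \<subseteq> Poly_Mapping.keys m"
    by blast
  then show "part m (pmap V) x = mulv B d (part m V) x"
  proof cases
    case 1
    have "d x y = 0" for y using 1 supp[of x y] by auto
    then show ?thesis using 1 by (simp add: part_def mulv_def)
  next
    case 2
    have "d x y * part m V y = 0" for y
      using 2 supp[of x y] by (cases "d x y = 0") (auto simp: part_def)
    then have "mulv B d (part m V) x = 0" by (simp add: mulv_def)
    then show ?thesis using 2 by (simp add: part_def)
  next
    case 3
    define l where "l = m - chi (\<mu> x)"
    have l: "chi (\<mu> x) + l = m" unfolding l_def using 3 finite_\<mu> by (simp add: chi_minus)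
    have "Poly_Mapping.lookup (mon x y * V y) l = d x y * part m V y" if "y \<in> B" for y
    proof (cases "d x y = 0")
      case False
      have sub: "\<mu> x \<subseteq> \<mu> y" and fin: "finite (\<mu> y)" "finite (\<mu> x)"
        using False supp[of x y] finite_\<mu> by auto
      show ?thesis
      proof (cases "\<mu> y \<subseteq> Poly_Mapping.keys m")
        case True
        have "chi (\<mu> x) + l = chi (\<mu> x) + (chi (\<mu> y - \<mu> x) + (m - chi (\<mu> y)))"
          using chi_minus[OF fin(1) True] chi_split[OF fin(1) sub] l by (simp add: add.assoc)
        then have "l = chi (\<mu> y - \<mu> x) + (m - chi (\<mu> y))" by (rule add_left_imp_eq)
        then show ?thesis using True \<open>y \<in> B\<close> by (simp add: mon_def lookup_single_mult_add part_def)
      next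
        case notin: False
        \<comment> \<open>Such a variable divides the monomial of \<open>mon x y\<close> but not the
          one with exponent \<open>l\<close>, so this summand contributes nothing.\<close>
        then obtain i where "i \<in> \<mu> y" "i \<notin> Poly_Mapping.keys m" by blast
        then have i: "i \<in> \<mu> y" "Poly_Mapping.lookup m i = 0" by (auto simp: in_keys_iff)
        then have ix: "i \<notin> \<mu> x" using 3 by (auto simp: in_keys_iff)
        have "Poly_Mapping.lookup l i = 0" using i by (simp add: l_def lookup_minus)
        then have "l \<noteq> chi (\<mu> y - \<mu> x) + l'" for l' using i ix fin by (auto simp: lookup_add lookup_chi)
        then show ?thesis using notin by (simp add: mon_def lookup_single_mult_not part_def)
      qed
    qed (simp add: mon_def)
    then show ?thesis using 3 by (simp add: part_def pmap_def mulv_def lookup_sum l_def)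
  qed
qed

lemma pmap_outside: "x \<notin> B \<Longrightarrow> pmap V x = 0"
  unfolding pmap_def using mon_nonzero[of x] by (intro sum.neutral) auto

lemma pmap_polys: "(\<And>b. V b \<in> polys n) \<Longrightarrow> pmap V b \<in> polys n"
  unfolding pmap_def by (intro polys_sum polys_mult mon_polys)

lemma pmap_pmap: "pmap (pmap V) = (\<lambda>_. 0)"
proof (rule part_eqI)
  show "part m (pmap (pmap V)) = part m (\<lambda>_. 0)" for m
    by (simp only: part_pmap mulv_mulv) (simp add: part_def fun_eq_iff)
qed (simp add: pmap_outside)

lemma pmap_base:
  assumes "\<And>b. V b \<in> polys n" shows "pmap V z \<in> squarefree_ideal n I"
  unfolding squarefree_ideal_def
proof (safe intro!: pmap_polys assms)
  fix m assume "m \<in> Poly_Mapping.keys (pmap V z)"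
  then have "part m (pmap V) z \<noteq> 0" using base by (simp add: part_def in_keys_iff)
  then show "Poly_Mapping.keys m \<in> I" unfolding part_pmap using part_strand by (rule mulv_base[rotated])
qed

text \<open>Preimages are chosen in each multidegree separately and summed. Only the finitely many
  multidegrees in \<open>M\<close> occur in \<open>W\<close>, so the sum is again a vector of
  polynomials.\<close>

lemma pmap_exact:
  assumes W: "\<And>b. W b \<in> polys n" "\<And>b. b \<notin> B \<Longrightarrow> W b = 0"
    and cycle: "pmap W = (\<lambda>_. 0)" and aug: "W z \<in> squarefree_ideal n I"
  obtains V where "\<And>b. V b \<in> polys n" "W = pmap V"
proof -
  have "\<exists>w. w \<in> strand B \<mu> (Poly_Mapping.keys m) \<and> part m W = mulv B d w" for m
  proof -
    have "mulv B d (part m W) = (\<lambda>_. 0)"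
      by (simp only: cycle flip: part_pmap) (simp add: part_def fun_eq_iff)
    moreover have "part m W z = 0 \<or> Poly_Mapping.keys m \<in> I"
      using aug base by (auto simp: part_def squarefree_ideal_def in_keys_iff)
    ultimately show ?thesis using exact[OF part_strand] by blast
  qed
  then obtain w where w: "w m \<in> strand B \<mu> (Poly_Mapping.keys m)" "part m W = mulv B d (w m)" for m
    by metis
  define M where "M = (\<Union>b\<in>B. (\<lambda>k. chi (\<mu> b) + k) ` Poly_Mapping.keys (W b))"
  have finM: "finite M" unfolding M_def using fin by simp
  have M_bound: "Poly_Mapping.keys m \<subseteq> {1..n}" if mM: "m \<in> M" for m
  proof -
    obtain b k where m: "m = chi (\<mu> b) + k" "b \<in> B" "k \<in> Poly_Mapping.keys (W b)"
      using mM unfolding M_def by blast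
    have "Poly_Mapping.keys k \<subseteq> {1..n}" using W(1)[of b] m(3) unfolding polys_def by blast
    then show ?thesis using keys_add[of "chi (\<mu> b)" k] bounded[OF m(2)] m finite_\<mu>[OF m(2)]
      by (auto simp: keys_chi)
  qed
  have M_out: "part m W = (\<lambda>_. 0)" if "m \<notin> M" for m
  proof
    fix b
    show "part m W b = 0"
    proof (rule ccontr)
      assume nz: "part m W b \<noteq> 0"
      then have b: "b \<in> B" "\<mu> b \<subseteq> Poly_Mapping.keys m" "m - chi (\<mu> b) \<in> Poly_Mapping.keys (W b)"
        by (auto simp: part_def in_keys_iff split: if_splits)
      then have "chi (\<mu> b) + (m - chi (\<mu> b)) \<in> M" unfolding M_def by blast
      then show False using that chi_minus[OF finite_\<mu>[OF b(1)] b(2)] by simp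
    qed
  qed
  define V where "V y = (\<Sum>m\<in>M. Poly_Mapping.single (m - chi (\<mu> y)) (w m y))" for y
  have part_V: "part m V = (if m \<in> M then w m else (\<lambda>_. 0))" for m
  proof
    fix y
    show "part m V y = (if m \<in> M then w m else (\<lambda>_. 0)) y"
    proof (cases "y \<in> B \<and> \<mu> y \<subseteq> Poly_Mapping.keys m")
      case True
      then have ym: "chi (\<mu> y) + (m - chi (\<mu> y)) = m" using finite_\<mu> by (simp add: chi_minus)
      \<comment> \<open>Truncated subtraction of \<open>chi (\<mu> y)\<close> is injective only on
        exponents divisible by it; a nonzero \<open>w m' y\<close> ensures that \<open>m'\<close> is
        one of them.\<close>
      have "Poly_Mapping.lookup (Poly_Mapping.single (m' - chi (\<mu> y)) (w m' y)) (m - chi (\<mu> y)) =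
          (if m' = m then w m y else 0)" for m'
      proof (cases "w m' y = 0")
        case False
        then have "\<mu> y \<subseteq> Poly_Mapping.keys m'" using w(1)[of m'] unfolding strand_def by auto
        then have "chi (\<mu> y) + (m' - chi (\<mu> y)) = m'" using True finite_\<mu> by (simp add: chi_minus)
        then have "m' - chi (\<mu> y) = m - chi (\<mu> y) \<longleftrightarrow> m' = m" using ym by metis
        then show ?thesis by (simp add: lookup_single when_def)
      qed auto
      then have "part m V y = (\<Sum>m'\<in>M. if m' = m then w m y else 0)"
        using True by (simp add: part_def V_def lookup_sum)
      then show ?thesis using finM by simp
    next
      case False
      then have "w m y = 0" using w(1)[of m] unfolding strand_def by blast
      then show ?thesis using False by (auto simp: part_def)
    qed
  qed
  show thesis
  proof (rule that)
    show "V b \<in> polys n" for b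
      unfolding V_def using M_bound keys_minus_nat by (intro polys_sum polys_single) blast
    show "W = pmap V"
    proof (rule part_eqI)
      show "part m W = part m (pmap V)" for m
        unfolding part_pmap part_V using w(2) M_out by (cases "m \<in> M") (auto simp: mulv_def)
      show "W b = pmap V b" if "b \<notin> B" for b using that W(2) pmap_outside by simp
    qed
  qed
qed

lemma pmap_restrict:
  assumes "W = pmap V" and hom: "\<And>x. W x \<noteq> 0 \<Longrightarrow> h x = k"
  shows "W = pmap (\<lambda>b. if b \<in> B \<and> h b = Suc k then V b else 0)"
proof
  fix x
  have eq: "mon x y * (if y \<in> B \<and> h y = Suc k then V y else 0) = (if h x = k then mon x y * V y else 0)" for y
    using mon_nonzero[of x y] by (cases "mon x y = 0") auto
  show "W x = pmap (\<lambda>b. if b \<in> B \<and> h b = Suc k then V b else 0) x"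
    using hom[of x] unfolding pmap_def[of "\<lambda>b. if b \<in> B \<and> h b = Suc k then V b else 0"] eq
    by (cases "h x = k") (auto simp: assms(1) pmap_def)
qed

end

text \<open>The lists \<open>bs i\<close> order the basis in each homological degree for the passage
  to vectors and matrices; \<open>minimal\<close> excludes unit entries.\<close>

locale minimal_polynomial_resolution = polynomial_resolution I B h \<mu> d z n
  for I :: "nat set set" and B :: "'b set" and h :: "'b \<Rightarrow> nat" and \<mu> :: "'b \<Rightarrow> nat set"
    and d :: "'b \<Rightarrow> 'b \<Rightarrow> 'k::field" and z :: 'b and n :: nat +
  fixes bs :: "nat \<Rightarrow> 'b list"
  assumes minimal: "d b c \<noteq> 0 \<Longrightarrow> \<mu> b \<noteq> \<mu> c"
    and bs: "distinct (bs i)" "set (bs i) = {b \<in> B. h b = i}"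
begin

definition shifts :: "nat \<Rightarrow> int list" where
  "shifts i = map (\<lambda>b. int (card (\<mu> b))) (bs i)"

definition dmat :: "nat \<Rightarrow> 'k mpoly mat" where
  "dmat i = mat (length (bs i)) (length (bs (Suc i))) (\<lambda>(r, c). mon (bs i ! r) (bs (Suc i) ! c))"

text \<open>Extension by zero from degree \<open>i\<close> to the whole basis, so that the single
  map \<open>pmap\<close> serves all degrees.\<close>

definition coord :: "nat \<Rightarrow> 'k mpoly vec \<Rightarrow> 'b \<Rightarrow> 'k mpoly" where
  "coord i v b = (\<Sum>r<length (bs i). if bs i ! r = b then v $ r else 0)"

lemma length_shifts [simp]: "length (shifts i) = length (bs i)" by (simp add: shifts_def)

lemma dmat_carrier [simp]: "dmat i \<in> carrier_mat (length (bs i)) (length (bs (Suc i)))"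
  by (simp add: dmat_def)

lemma coord_nth:
  assumes "r < length (bs i)" shows "coord i v (bs i ! r) = v $ r"
proof -
  have "coord i v (bs i ! r) = (\<Sum>s<length (bs i). if s = r then v $ r else 0)"
    unfolding coord_def
    by (rule sum.cong) (use assms bs(1)[of i] in \<open>auto simp: nth_eq_iff_index_eq\<close>)
  then show ?thesis using assms by simp
qed

lemma coord_outside: "b \<notin> set (bs i) \<Longrightarrow> coord i v b = 0"
  unfolding coord_def by (intro sum.neutral) auto

lemma coord_zero: "coord i (0\<^sub>v (length (bs i))) = (\<lambda>_. 0)"
proof
  fix b show "coord i (0\<^sub>v (length (bs i))) b = 0"
    unfolding coord_def by (rule sum.neutral) simp
qed

lemma coord_inject:
  assumes "v \<in> carrier_vec (length (bs i))" "w \<in> carrier_vec (length (bs i))" "coord i v = coord i w"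
  shows "v = w"
proof (rule eq_vecI)
  fix r assume "r < dim_vec w"
  then have r: "r < length (bs i)" using assms by simp
  show "v $ r = w $ r" using fun_cong[OF assms(3), of "bs i ! r"] by (simp add: coord_nth[OF r])
qed (use assms in simp)

lemma coord_polys: "v \<in> free_module n (length (bs i)) \<Longrightarrow> coord i v b \<in> polys n"
  unfolding coord_def free_module_def by (intro polys_sum) auto

lemma pmap_coord:
  assumes w: "w \<in> carrier_vec (length (bs (Suc i)))"
  shows "pmap (coord (Suc i) w) = coord i (dmat i *\<^sub>v w)"
proof
  fix x
  show "pmap (coord (Suc i) w) x = coord i (dmat i *\<^sub>v w) x"
  proof (cases "x \<in> set (bs i)")
    case True
    then obtain r where r: "r < length (bs i)" "x = bs i ! r" by (auto simp: in_set_conv_nth)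
    have "pmap (coord (Suc i) w) x = (\<Sum>y\<in>set (bs (Suc i)). mon x y * coord (Suc i) w y)"
      unfolding pmap_def
      by (rule sum.mono_neutral_right) (use fin bs(2) coord_outside in auto)
    also have "\<dots> = (\<Sum>c<length (bs (Suc i)). mon x (bs (Suc i) ! c) * coord (Suc i) w (bs (Suc i) ! c))"
      by (rule sum.reindex_bij_betw[symmetric, OF bij_betw_nth[OF bs(1) refl refl]])
    also have "\<dots> = (\<Sum>c<length (bs (Suc i)). mon x (bs (Suc i) ! c) * w $ c)"
      by (simp add: coord_nth)
    also have "\<dots> = (dmat i *\<^sub>v w) $ r"
      using r w by (simp add: dmat_def scalar_prod_def lessThan_atLeast0)
    finally show ?thesis using r by (simp add: coord_nth)
  next
    case False
    have "mon x y * coord (Suc i) w y = 0" for y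
    proof (cases "y \<in> set (bs (Suc i)) \<and> mon x y \<noteq> 0")
      case True
      then show ?thesis using False mon_nonzero[of x y] bs(2) by auto
    qed (auto simp: coord_outside)
    then show ?thesis using False by (simp add: coord_outside pmap_def)
  qed
qed

text \<open>One criterion for every degree. For \<open>i = 0\<close> every vector is a cycle and
  membership in the ideal remains; for \<open>i > 0\<close> the coordinate at \<open>z\<close> is
  zero and the cycle condition remains.\<close>

lemma image_dmat_iff:
  assumes v: "v \<in> free_module n (length (bs i))"
  shows "v \<in> (\<lambda>w. dmat i *\<^sub>v w) ` free_module n (length (bs (Suc i))) \<longleftrightarrow>
    pmap (coord i v) = (\<lambda>_. 0) \<and> coord i v z \<in> squarefree_ideal n I"
proof
  assume "v \<in> (\<lambda>w. dmat i *\<^sub>v w) ` free_module n (length (bs (Suc i)))"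
  then obtain w where w: "w \<in> free_module n (length (bs (Suc i)))" "v = dmat i *\<^sub>v w" by blast
  then have "coord i v = pmap (coord (Suc i) w)" by (simp add: pmap_coord free_module_def)
  then show "pmap (coord i v) = (\<lambda>_. 0) \<and> coord i v z \<in> squarefree_ideal n I"
    using coord_polys[OF w(1)] by (simp add: pmap_pmap pmap_base)
next
  assume cyc: "pmap (coord i v) = (\<lambda>_. 0) \<and> coord i v z \<in> squarefree_ideal n I"
  have zero: "coord i v b = 0" if "\<not> (b \<in> B \<and> h b = i)" for b
    using that bs(2) by (intro coord_outside) auto
  have "coord i v b = 0" if "b \<notin> B" for b using that zero by blast
  then obtain V where V: "\<And>b. V b \<in> polys n" "coord i v = pmap V"
    using pmap_exact[OF coord_polys[OF v] _ conjunct1[OF cyc] conjunct2[OF cyc]] by blast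
  have hom: "h x = i" if "coord i v x \<noteq> 0" for x using that zero[of x] by auto
  define V' where "V' b = (if b \<in> B \<and> h b = Suc i then V b else 0)" for b
  have V': "coord i v = pmap V'"
    unfolding V'_def by (rule pmap_restrict[OF V(2) hom])
  define w where "w = vec (length (bs (Suc i))) (\<lambda>c. V' (bs (Suc i) ! c))"
  have w: "w \<in> free_module n (length (bs (Suc i)))"
    using V(1) by (auto simp: free_module_def w_def V'_def)
  have "coord (Suc i) w = V'"
  proof
    fix b
    show "coord (Suc i) w b = V' b"
    proof (cases "b \<in> set (bs (Suc i))")
      case True
      then obtain r where r: "r < length (bs (Suc i))" "b = bs (Suc i) ! r" by (auto simp: in_set_conv_nth)
      then show ?thesis by (simp add: coord_nth w_def)
    next
      case False
      then show ?thesis using bs(2) by (auto simp: coord_outside V'_def)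
    qed
  qed
  then have "coord i (dmat i *\<^sub>v w) = coord i v"
    using w V' by (simp add: free_module_def flip: pmap_coord)
  then have "dmat i *\<^sub>v w = v"
    by (rule coord_inject[rotated 2])
      (use v w in \<open>auto simp: free_module_def intro!: mult_mat_vec_carrier[OF dmat_carrier]\<close>)
  then show "v \<in> (\<lambda>w. dmat i *\<^sub>v w) ` free_module n (length (bs (Suc i)))" using w by blast
qed

lemma dmat_free_module:
  assumes w: "w \<in> free_module n (length (bs (Suc i)))"
  shows "dmat i *\<^sub>v w \<in> free_module n (length (bs i))"
proof -
  have wc: "w \<in> carrier_vec (length (bs (Suc i)))" using w by (simp add: free_module_def)
  have "(dmat i *\<^sub>v w) $ r \<in> polys n" if "r < length (bs i)" for r
  proof -
    have "(dmat i *\<^sub>v w) $ r = pmap (coord (Suc i) w) (bs i ! r)"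
      using pmap_coord[OF wc] coord_nth[OF that] by simp
    then show ?thesis using coord_polys[OF w] pmap_polys by simp
  qed
  then show ?thesis using wc unfolding free_module_def
    by (auto intro!: mult_mat_vec_carrier[OF dmat_carrier])
qed

lemma bs_0: "bs 0 = [z]"
proof -
  have set: "set (bs 0) = {z}" unfolding bs(2) using base base_unique by blast
  then have "length (bs 0) = Suc 0" using distinct_card[OF bs(1)[of 0]] by simp
  then obtain b where "bs 0 = [b]" unfolding length_Suc_conv by auto
  then show ?thesis using set by simp
qed

lemma dmat_entry:
  assumes "r < length (bs i)" "c < length (bs (Suc i))"
  shows "dmat i $$ (r, c) = mon (bs i ! r) (bs (Suc i) ! c)"
  using assms by (simp add: dmat_def)

lemma minimal_resolution:
  "minimal_graded_free_resolution n (squarefree_ideal n I) shifts dmat"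
  unfolding minimal_graded_free_resolution_def length_shifts
proof (intro conjI allI impI)
  show "shifts 0 = [0]" by (simp add: shifts_def bs_0 base)
  fix i
  show "dmat i \<in> carrier_mat (length (bs i)) (length (bs (Suc i)))" by simp
  show "(\<lambda>v. dmat (Suc i) *\<^sub>v v) ` free_module n (length (bs (Suc (Suc i)))) =
      mat_kernel (dmat i) \<inter> free_module n (length (bs (Suc i)))"
  proof (intro equalityI subsetI)
    fix v
    assume v: "v \<in> (\<lambda>v. dmat (Suc i) *\<^sub>v v) ` free_module n (length (bs (Suc (Suc i))))"
    then have vf: "v \<in> free_module n (length (bs (Suc i)))" using dmat_free_module by blast
    then have vc: "v \<in> carrier_vec (length (bs (Suc i)))" by (simp add: free_module_def)
    have "coord i (dmat i *\<^sub>v v) = (\<lambda>_. 0)"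
      using v unfolding image_dmat_iff[OF vf] pmap_coord[OF vc] by (rule conjunct1)
    also have "\<dots> = coord i (0\<^sub>v (length (bs i)))" by (rule coord_zero[symmetric])
    finally have "dmat i *\<^sub>v v = 0\<^sub>v (length (bs i))"
      by (rule coord_inject[rotated 2]) (use vc in \<open>auto intro!: mult_mat_vec_carrier[OF dmat_carrier]\<close>)
    then show "v \<in> mat_kernel (dmat i) \<inter> free_module n (length (bs (Suc i)))"
      using mat_kernelI[OF dmat_carrier vc] vf by simp
  next
    fix v assume v: "v \<in> mat_kernel (dmat i) \<inter> free_module n (length (bs (Suc i)))"
    then have vf: "v \<in> free_module n (length (bs (Suc i)))" by blast
    then have vc: "v \<in> carrier_vec (length (bs (Suc i)))" by (simp add: free_module_def)
    have "dmat i *\<^sub>v v = 0\<^sub>v (length (bs i))"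
      using mat_kernelD(2)[OF dmat_carrier] v by simp
    then have "pmap (coord (Suc i) v) = (\<lambda>_. 0)"
      unfolding pmap_coord[OF vc] by (simp add: coord_zero)
    moreover have "coord (Suc i) v z = 0" using bs(2) base by (intro coord_outside) simp
    ultimately show "v \<in> (\<lambda>v. dmat (Suc i) *\<^sub>v v) ` free_module n (length (bs (Suc (Suc i))))"
      unfolding image_dmat_iff[OF vf] by (simp add: squarefree_ideal_def)
  qed
next
  fix i r c assume rc: "r < length (bs i)" "c < length (bs (Suc i))"
  define x y where "x = bs i ! r" and "y = bs (Suc i) ! c"
  have e: "dmat i $$ (r, c) = mon x y" using dmat_entry[OF rc] by (simp add: x_def y_def)
  show "dmat i $$ (r, c) \<in> polys n" unfolding e by (rule mon_polys)
  have "homogeneous (int (card (\<mu> y)) - int (card (\<mu> x))) (mon x y)"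
  proof (cases "d x y = 0")
    case False
    then have fin: "finite (\<mu> x)" "finite (\<mu> y)" and sub: "\<mu> x \<subseteq> \<mu> y"
      using supp[of x y] finite_\<mu> by auto
    have "int (card (\<mu> y - \<mu> x)) = int (card (\<mu> y)) - int (card (\<mu> x))"
      using card_Diff_subset[OF fin(1) sub] card_mono[OF fin(2) sub] by simp
    then show ?thesis using fin unfolding homogeneous_def mon_def by (simp add: degree_chi)
  qed (simp add: homogeneous_def mon_def)
  then show "homogeneous (shifts (Suc i) ! c - shifts i ! r) (dmat i $$ (r, c))"
    using rc unfolding e by (simp add: shifts_def x_def y_def)
  \<comment> \<open>A nonzero constant term would force equal multidegrees of row and
    column.\<close>
  show "Poly_Mapping.lookup (dmat i $$ (r, c)) 0 = 0"
  proof (rule ccontr)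
    assume "Poly_Mapping.lookup (dmat i $$ (r, c)) 0 \<noteq> 0"
    then have nz: "d x y \<noteq> 0" and chi: "chi (\<mu> y - \<mu> x) = 0"
      unfolding e mon_def by (auto simp: lookup_single when_def split: if_splits)
    have "finite (\<mu> y - \<mu> x)" and sub: "\<mu> x \<subseteq> \<mu> y" using supp[OF nz] finite_\<mu> by auto
    then have "\<mu> y - \<mu> x = {}" using keys_chi[of "\<mu> y - \<mu> x"] chi by simp
    then show False using minimal[OF nz] sub by blast
  qed
next
  show "(\<lambda>v. dmat 0 *\<^sub>v v) ` free_module n (length (bs 1)) =
      {v \<in> free_module n 1. v $ 0 \<in> squarefree_ideal n I}"
  proof -
    have len: "length (bs 0) = 1" by (simp add: bs_0)
    have z: "coord 0 v z = v $ 0" for v using coord_nth[of 0 0 v] by (simp add: bs_0)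
    have cyc: "pmap (coord 0 v) = (\<lambda>_. 0)" for v
    proof
      fix x
      have "mon x y * coord 0 v y = 0" for y
        using mon_nonzero[of x y] coord_outside[of y 0 v] bs(2)[of 0] by (cases "mon x y = 0") auto
      then show "pmap (coord 0 v) x = 0" by (simp add: pmap_def)
    qed
    have "v \<in> (\<lambda>w. dmat 0 *\<^sub>v w) ` free_module n (length (bs (Suc 0))) \<longleftrightarrow>
        v $ 0 \<in> squarefree_ideal n I" if "v \<in> free_module n 1" for v
      using image_dmat_iff[of v 0] that cyc z len by simp
    moreover have "(\<lambda>w. dmat 0 *\<^sub>v w) ` free_module n (length (bs (Suc 0))) \<subseteq> free_module n 1"
      using dmat_free_module[of _ 0] len by auto
    ultimately have "(\<lambda>w. dmat 0 *\<^sub>v w) ` free_module n (length (bs (Suc 0))) =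
        {v \<in> free_module n 1. v $ 0 \<in> squarefree_ideal n I}" by blast
    then show ?thesis by simp
  qed
qed

end

section \<open>Uniqueness of the Betti numbers\<close>

lemma monomial_degree_superset:
  assumes "finite A" "Poly_Mapping.keys m \<subseteq> A"
  shows "monomial_degree m = (\<Sum>x\<in>A. Poly_Mapping.lookup m x)"
  unfolding monomial_degree_def
  by (rule sum.mono_neutral_left) (use assms in \<open>auto simp: in_keys_iff\<close>)

lemma monomial_degree_add: "monomial_degree (a + b) = monomial_degree a + monomial_degree b"
proof -
  let ?A = "Poly_Mapping.keys a \<union> Poly_Mapping.keys b"
  have "monomial_degree (a + b) = (\<Sum>x\<in>?A. Poly_Mapping.lookup (a + b) x)"
    by (intro monomial_degree_superset keys_add) simp
  moreover have "monomial_degree a = (\<Sum>x\<in>?A. Poly_Mapping.lookup a x)"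
    "monomial_degree b = (\<Sum>x\<in>?A. Poly_Mapping.lookup b x)"
    by (intro monomial_degree_superset; simp)+
  ultimately show ?thesis by (simp add: lookup_add sum.distrib)
qed

lemma monomial_degree_zero [simp]: "monomial_degree 0 = 0" by (simp add: monomial_degree_def)

lemma homogeneous_zero [simp]: "homogeneous e 0" by (simp add: homogeneous_def)

lemma homogeneous_one: "homogeneous 0 1" by (simp add: homogeneous_def)

lemma homogeneous_add: "homogeneous e f \<Longrightarrow> homogeneous e g \<Longrightarrow> homogeneous e (f + g)"
  unfolding homogeneous_def using keys_add[of f g] by blast

lemma homogeneous_minus: "homogeneous e f \<Longrightarrow> homogeneous e g \<Longrightarrow> homogeneous e (f - g)"
  using homogeneous_add[of e f "- g"] unfolding homogeneous_def by (auto simp: in_keys_iff)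

lemma homogeneous_sum: "(\<And>x. x \<in> A \<Longrightarrow> homogeneous e (f x)) \<Longrightarrow> homogeneous e (sum f A)"
  by (induction A rule: infinite_finite_induct) (auto intro: homogeneous_add)

lemma homogeneous_mult:
  assumes "homogeneous e f" "homogeneous e' g" shows "homogeneous (e + e') (f * g)"
  unfolding homogeneous_def
proof
  fix m assume "m \<in> Poly_Mapping.keys (f * g)"
  then obtain a b where "m = a + b" "a \<in> Poly_Mapping.keys f" "b \<in> Poly_Mapping.keys g"
    using keys_mult by blast
  then show "int (monomial_degree m) = e + e'"
    using assms by (simp add: homogeneous_def monomial_degree_add)
qed

lemma homogeneous_const:
  assumes "homogeneous e f" "Poly_Mapping.lookup f 0 \<noteq> 0" shows "e = 0"
proof -
  have "0 \<in> Poly_Mapping.keys f" using assms(2) by (simp add: in_keys_iff)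
  then show ?thesis using assms(1) unfolding homogeneous_def by fastforce
qed

definition hom_part :: "int \<Rightarrow> 'k::field mpoly \<Rightarrow> 'k mpoly" where
  "hom_part e f = (\<Sum>m | m \<in> Poly_Mapping.keys f \<and> int (monomial_degree m) = e.
     Poly_Mapping.single m (Poly_Mapping.lookup f m))"

lemma lookup_hom_part:
  "Poly_Mapping.lookup (hom_part e f) m = (if int (monomial_degree m) = e then Poly_Mapping.lookup f m else 0)"
  by (auto simp: hom_part_def lookup_sum lookup_single when_def in_keys_iff)

lemma homogeneous_hom_part: "homogeneous e (hom_part e f)"
  by (auto simp: homogeneous_def in_keys_iff lookup_hom_part split: if_splits)

lemma hom_part_polys: "f \<in> polys n \<Longrightarrow> hom_part e f \<in> polys n"
  unfolding polys_def by (auto simp: in_keys_iff lookup_hom_part split: if_splits)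

lemma hom_part_add: "hom_part e (f + g) = hom_part e f + hom_part e g"
  by (intro poly_mapping_eqI) (simp add: lookup_hom_part lookup_add)

lemma hom_part_sum: "hom_part e (sum f A) = (\<Sum>x\<in>A. hom_part e (f x))"
  by (intro poly_mapping_eqI) (simp add: lookup_hom_part lookup_sum)

lemma hom_part_homogeneous: "homogeneous e f \<Longrightarrow> hom_part e f = f"
  by (intro poly_mapping_eqI) (auto simp: lookup_hom_part homogeneous_def in_keys_iff)

lemma hom_part_mult:
  assumes "homogeneous e f" shows "hom_part (e + e') (f * g) = f * hom_part e' g"
proof -
  \<comment> \<open>Without its component of degree \<open>e'\<close>, the rest of \<open>g\<close>
    cannot contribute to degree \<open>e + e'\<close> of the product.\<close>
  define g' where "g' = g - hom_part e' g"
  have "hom_part (e + e') (f * g') = 0"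
  proof (rule poly_mapping_eqI)
    fix m
    have "m \<notin> Poly_Mapping.keys (f * g')" if deg: "int (monomial_degree m) = e + e'"
    proof
      assume "m \<in> Poly_Mapping.keys (f * g')"
      then obtain a b where ab: "m = a + b" "a \<in> Poly_Mapping.keys f" "b \<in> Poly_Mapping.keys g'"
        using keys_mult by blast
      then have "int (monomial_degree b) = e'"
        using assms deg by (simp add: homogeneous_def monomial_degree_add)
      then show False using ab(3) by (simp add: g'_def in_keys_iff lookup_minus lookup_hom_part)
    qed
    then show "Poly_Mapping.lookup (hom_part (e + e') (f * g')) m = Poly_Mapping.lookup 0 m"
      by (simp add: lookup_hom_part in_keys_iff)
  qed
  moreover have "f * g = f * hom_part e' g + f * g'" by (simp add: g'_def algebra_simps)
  moreover have "hom_part (e + e') (f * hom_part e' g) = f * hom_part e' g"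
    by (intro hom_part_homogeneous homogeneous_mult assms homogeneous_hom_part)
  ultimately show ?thesis by (simp add: hom_part_add)
qed

text \<open>The constant term is reduction modulo the variables, and it is multiplicative because a
  zero exponent is a sum of exponents only as 0 + 0.\<close>

lemma lookup_mult_0:
  fixes f g :: "'k::field mpoly"
  shows "Poly_Mapping.lookup (f * g) 0 = Poly_Mapping.lookup f 0 * Poly_Mapping.lookup g 0"
proof -
  define f' where "f' = f - Poly_Mapping.single 0 (Poly_Mapping.lookup f 0)"
  have "0 \<notin> Poly_Mapping.keys (f' * g)"
  proof
    assume "0 \<in> Poly_Mapping.keys (f' * g)"
    then obtain a b where ab: "0 = a + b" "a \<in> Poly_Mapping.keys f'" using keys_mult by blast
    have "a = 0"
    proof (rule poly_mapping_eqI)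
      fix i
      have "Poly_Mapping.lookup a i + Poly_Mapping.lookup b i = 0"
        using ab(1) lookup_add[of a b i] by simp
      then show "Poly_Mapping.lookup a i = Poly_Mapping.lookup 0 i" by simp
    qed
    then show False using ab(2) by (simp add: f'_def in_keys_iff lookup_minus)
  qed
  then have "Poly_Mapping.lookup (f' * g) 0 = 0" by (simp add: in_keys_iff)
  moreover have "f * g = Poly_Mapping.single 0 (Poly_Mapping.lookup f 0) * g + f' * g"
    by (simp add: f'_def algebra_simps)
  moreover have "Poly_Mapping.lookup (Poly_Mapping.single 0 (Poly_Mapping.lookup f 0) * g) 0 =
      Poly_Mapping.lookup f 0 * Poly_Mapping.lookup g 0"
    using lookup_single_mult_add[of 0 "Poly_Mapping.lookup f 0" g 0] by simp
  ultimately show ?thesis by (simp add: lookup_add)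
qed

section \<open>Matrices of degree zero and their lifts\<close>

definition graded_mat :: "nat \<Rightarrow> int list \<Rightarrow> int list \<Rightarrow> 'k::field mpoly mat \<Rightarrow> bool" where
  "graded_mat n a b M \<longleftrightarrow> M \<in> carrier_mat (length a) (length b) \<and>
     (\<forall>r<length a. \<forall>c<length b. M $$ (r, c) \<in> polys n \<and> homogeneous (b ! c - a ! r) (M $$ (r, c)))"

lemma graded_mat_carrier: "graded_mat n a b M \<Longrightarrow> M \<in> carrier_mat (length a) (length b)"
  by (simp add: graded_mat_def)

lemma graded_mat_mult:
  assumes "graded_mat n a b M" "graded_mat n b c N"
  shows "graded_mat n a c (M * N)"
  unfolding graded_mat_def
proof (intro conjI allI impI)
  have M: "M \<in> carrier_mat (length a) (length b)" and N: "N \<in> carrier_mat (length b) (length c)"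
    using assms by (auto simp: graded_mat_def)
  then show "M * N \<in> carrier_mat (length a) (length c)" by simp
  fix r s assume rs: "r < length a" "s < length c"
  have e: "(M * N) $$ (r, s) = (\<Sum>i<length b. M $$ (r, i) * N $$ (i, s))"
    using M N rs by (simp add: scalar_prod_def lessThan_atLeast0)
  show "(M * N) $$ (r, s) \<in> polys n"
    unfolding e using assms rs by (auto simp: graded_mat_def intro!: polys_sum polys_mult)
  have "homogeneous ((b ! i - a ! r) + (c ! s - b ! i)) (M $$ (r, i) * N $$ (i, s))"
    if "i < length b" for i
    using assms rs that by (intro homogeneous_mult) (auto simp: graded_mat_def)
  then show "homogeneous (c ! s - a ! r) ((M * N) $$ (r, s))"
    unfolding e by (intro homogeneous_sum) simp
qed

lemma graded_mat_minus:
  assumes M: "graded_mat n a b M" and N: "graded_mat n a b N"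
  shows "graded_mat n a b (M - N)"
  unfolding graded_mat_def
proof (intro conjI allI impI)
  show "M - N \<in> carrier_mat (length a) (length b)"
    using N by (auto simp: graded_mat_def)
  fix r s assume rs: "r < length a" "s < length b"
  have e: "(M - N) $$ (r, s) = M $$ (r, s) - N $$ (r, s)"
    using graded_mat_carrier[OF N] rs by simp
  show "(M - N) $$ (r, s) \<in> polys n"
    unfolding e using M N rs by (auto simp: graded_mat_def intro!: polys_minus)
  show "homogeneous (b ! s - a ! r) ((M - N) $$ (r, s))"
    unfolding e using M N rs by (auto simp: graded_mat_def intro!: homogeneous_minus)
qed

lemma graded_mat_one: "graded_mat n a a (1\<^sub>m (length a))"
  by (auto simp: graded_mat_def homogeneous_one polys_def)

lemma graded_mat_zero: "graded_mat n a b (0\<^sub>m (length a) (length b))"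
  by (auto simp: graded_mat_def)

lemma graded_mat_col:
  "graded_mat n a b M \<Longrightarrow> c < length b \<Longrightarrow> col M c \<in> free_module n (length a)"
  by (auto simp: graded_mat_def free_module_def)

text \<open>Preimages of the columns need not be homogeneous. Since \<open>D\<close> and
  \<open>M\<close> are graded, replacing each entry by its component of the right degree keeps the
  equation and makes the lift graded.\<close>

lemma graded_lift:
  assumes D: "graded_mat n a b D" and M: "graded_mat n a c M"
    and im: "\<And>j. j < length c \<Longrightarrow> col M j \<in> (\<lambda>v. D *\<^sub>v v) ` free_module n (length b)"
  obtains X where "graded_mat n b c X" "D * X = M"
proof -
  have "\<exists>w. w \<in> free_module n (length b) \<and> col M j = D *\<^sub>v w" if "j < length c" for j
    using im[OF that] by blast
  then obtain w where w: "\<And>j. j < length c \<Longrightarrow> w j \<in> free_module n (length b)"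
    "\<And>j. j < length c \<Longrightarrow> col M j = D *\<^sub>v w j" by metis
  define X where "X = mat (length b) (length c) (\<lambda>(r, j). hom_part (c ! j - b ! r) (w j $ r))"
  have X: "graded_mat n b c X"
    using w(1) by (auto simp: graded_mat_def X_def free_module_def homogeneous_hom_part intro!: hom_part_polys)
  have Dc: "D \<in> carrier_mat (length a) (length b)" and Mc: "M \<in> carrier_mat (length a) (length c)"
    using D M by (auto simp: graded_mat_def)
  have "D * X = M"
  proof (rule eq_matI)
    fix i j assume "i < dim_row M" "j < dim_col M"
    then have i: "i < length a" and j: "j < length c" using Mc by auto
    have Mij: "M $$ (i, j) = (\<Sum>r<length b. D $$ (i, r) * w j $ r)"
    proof -
      have "M $$ (i, j) = col M j $ i" using i j Mc by simp
      also have "\<dots> = (\<Sum>r<length b. D $$ (i, r) * w j $ r)"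
      proof -
        have "dim_vec (w j) = length b" using w(1)[OF j] by (simp add: free_module_def)
        then show ?thesis unfolding w(2)[OF j] using Dc i
          by (simp add: scalar_prod_def lessThan_atLeast0)
      qed
      finally show ?thesis .
    qed
    have "(D * X) $$ (i, j) = (\<Sum>r<length b. D $$ (i, r) * hom_part (c ! j - b ! r) (w j $ r))"
      using i j Dc by (simp add: X_def scalar_prod_def lessThan_atLeast0)
    also have "\<dots> = (\<Sum>r<length b. hom_part (c ! j - a ! i) (D $$ (i, r) * w j $ r))"
    proof (rule sum.cong[OF refl])
      fix r assume "r \<in> {..<length b}"
      then have "homogeneous (b ! r - a ! i) (D $$ (i, r))" using D i by (simp add: graded_mat_def)
      from hom_part_mult[OF this, of "c ! j - b ! r" "w j $ r"]
      show "D $$ (i, r) * hom_part (c ! j - b ! r) (w j $ r) =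
          hom_part (c ! j - a ! i) (D $$ (i, r) * w j $ r)" by simp
    qed
    also have "\<dots> = hom_part (c ! j - a ! i) (M $$ (i, j))" by (simp add: Mij hom_part_sum)
    also have "\<dots> = M $$ (i, j)" using M i j by (intro hom_part_homogeneous) (simp add: graded_mat_def)
    finally show "(D * X) $$ (i, j) = M $$ (i, j)" .
  qed (use Dc Mc in \<open>auto simp: X_def\<close>)
  then show thesis using X that by blast
qed

text \<open>An identity matrix cannot factor through a smaller dimension. Padding both factors with
  zeros to square matrices reduces this to the fact that a left inverse is a right inverse.\<close>

lemma card_le_of_factorization:
  fixes P :: "'a \<Rightarrow> 'b \<Rightarrow> 'k::field"
  assumes "finite X" "finite Y"
    and PQ: "\<And>x x'. x \<in> X \<Longrightarrow> x' \<in> X \<Longrightarrow> (\<Sum>y\<in>Y. P x y * Q y x') = (if x = x' then 1 else 0)"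
  shows "card X \<le> card Y"
proof (rule ccontr)
  assume "\<not> card X \<le> card Y"
  obtain xs where xs: "set xs = X" "distinct xs" using assms(1) finite_distinct_list by blast
  obtain ys where ys: "set ys = Y" "distinct ys" using assms(2) finite_distinct_list by blast
  define m where "m = length xs"
  define l where "l = length ys"
  have lm: "l < m" using \<open>\<not> card X \<le> card Y\<close> distinct_card[OF xs(2)] distinct_card[OF ys(2)] xs ys
    by (simp add: m_def l_def)
  define A where "A = mat m m (\<lambda>(i, k). if k < l then P (xs ! i) (ys ! k) else 0)"
  define C where "C = mat m m (\<lambda>(k, i). if k < l then Q (ys ! k) (xs ! i) else 0)"
  have A: "A \<in> carrier_mat m m" and C: "C \<in> carrier_mat m m" by (auto simp: A_def C_def)
  have "A * C = 1\<^sub>m m"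
  proof (rule eq_matI)
    fix i j assume "i < dim_row (1\<^sub>m m :: 'k mat)" "j < dim_col (1\<^sub>m m :: 'k mat)"
    then have ij: "i < m" "j < m" by auto
    have "(A * C) $$ (i, j) = (\<Sum>k<m. if k < l then P (xs ! i) (ys ! k) * Q (ys ! k) (xs ! j) else 0)"
      using ij by (auto simp: A_def C_def scalar_prod_def lessThan_atLeast0 intro!: sum.cong)
    also have "\<dots> = (\<Sum>k<l. P (xs ! i) (ys ! k) * Q (ys ! k) (xs ! j))"
      using lm by (intro sum.mono_neutral_cong_right) auto
    also have "\<dots> = (\<Sum>y\<in>Y. P (xs ! i) y * Q y (xs ! j))"
      unfolding l_def by (rule sum.reindex_bij_betw[OF bij_betw_nth[OF ys(2) refl ys(1)[symmetric]]])
    also have "\<dots> = (1\<^sub>m m :: 'k mat) $$ (i, j)"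
      using ij xs by (subst PQ) (auto simp: m_def nth_eq_iff_index_eq)
    finally show "(A * C) $$ (i, j) = (1\<^sub>m m :: 'k mat) $$ (i, j)" .
  qed (auto simp: A_def C_def)
  then have "C * A = 1\<^sub>m m" by (rule mat_mult_left_right_inverse[OF A C])
  \<comment> \<open>Row \<open>l\<close> of \<open>C\<close> is padding, so the same entry is
    zero.\<close>
  then have "(C * A) $$ (l, l) = 1" using lm by simp
  moreover have "(C * A) $$ (l, l) = 0"
    using lm by (auto simp: A_def C_def scalar_prod_def intro!: sum.neutral)
  ultimately show False by simp
qed

lemma count_list_conv_card: "count_list xs x = card {i. i < length xs \<and> xs ! i = x}"
  unfolding count_list_eq_length_filter length_filter_conv_card by (metis (no_types))

section \<open>Comparison of two minimal graded resolutions\<close>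

locale graded_resolution =
  fixes n :: nat and I :: "'k::field mpoly set" and a :: "nat \<Rightarrow> int list" and D :: "nat \<Rightarrow> 'k mpoly mat"
  assumes resolution: "minimal_graded_free_resolution n I a D"
begin

lemma a_0: "a 0 = [0]"
  using resolution by (simp add: minimal_graded_free_resolution_def)

lemma graded: "graded_mat n (a i) (a (Suc i)) (D i)"
  using resolution by (simp add: minimal_graded_free_resolution_def graded_mat_def)

lemma image_0:
  "(\<lambda>v. D 0 *\<^sub>v v) ` free_module n (length (a 1)) = {v \<in> free_module n 1. v $ 0 \<in> I}"
  using resolution unfolding minimal_graded_free_resolution_def by (elim conjE)

lemma image_Suc: "(\<lambda>v. D (Suc i) *\<^sub>v v) ` free_module n (length (a (Suc (Suc i)))) =
    mat_kernel (D i) \<inter> free_module n (length (a (Suc i)))"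
  using resolution unfolding minimal_graded_free_resolution_def by (elim conjE allE)

lemma const_0:
  "r < length (a i) \<Longrightarrow> c < length (a (Suc i)) \<Longrightarrow> Poly_Mapping.lookup (D i $$ (r, c)) 0 = 0"
  using resolution unfolding minimal_graded_free_resolution_def by (elim conjE) simp

lemma D_carrier: "D i \<in> carrier_mat (length (a i)) (length (a (Suc i)))"
  using graded by (rule graded_mat_carrier)

lemma col_D:
  assumes "c < length (a (Suc i))"
  shows "col (D i) c \<in> (\<lambda>v. D i *\<^sub>v v) ` free_module n (length (a (Suc i)))"
proof -
  have "col (D i) c = D i *\<^sub>v unit_vec (length (a (Suc i))) c"
    using D_carrier[of i] assms by (intro eq_vecI) auto
  moreover have "unit_vec (length (a (Suc i))) c \<in> free_module n (length (a (Suc i)))"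
    using assms by (auto simp: free_module_def polys_def unit_vec_def)
  ultimately show ?thesis by blast
qed

lemma col_D_0: "c < length (a (Suc 0)) \<Longrightarrow> D 0 $$ (0, c) \<in> I"
  using col_D[of c 0] image_0 D_carrier[of 0] a_0 by auto

lemma D_D: "D i * D (Suc i) = 0\<^sub>m (length (a i)) (length (a (Suc (Suc i))))"
proof (rule mat_col_eqI)
  fix c assume "c < dim_col (0\<^sub>m (length (a i)) (length (a (Suc (Suc i)))) :: 'k mpoly mat)"
  then have c: "c < length (a (Suc (Suc i)))" by simp
  have "col (D (Suc i)) c \<in> mat_kernel (D i)" using col_D[OF c] image_Suc by blast
  then show "col (D i * D (Suc i)) c = col (0\<^sub>m (length (a i)) (length (a (Suc (Suc i))))) c"
    using mat_kernelD(2)[OF D_carrier] c by (simp add: col_mult2[OF D_carrier D_carrier c])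
qed (use D_carrier[of i] D_carrier[of "Suc i"] in auto)

lemma lift_0:
  assumes M: "graded_mat n (a 0) c M" and I: "\<And>j. j < length c \<Longrightarrow> M $$ (0, j) \<in> I"
  obtains X where "graded_mat n (a (Suc 0)) c X" "D 0 * X = M"
proof (rule graded_lift[OF graded M])
  fix j assume j: "j < length c"
  have "M \<in> carrier_mat 1 (length c)" using graded_mat_carrier[OF M] a_0 by simp
  then have "col M j $ 0 = M $$ (0, j)" using j by simp
  moreover have "col M j \<in> free_module n 1" using graded_mat_col[OF M j] a_0 by simp
  ultimately show "col M j \<in> (\<lambda>v. D 0 *\<^sub>v v) ` free_module n (length (a (Suc 0)))"
    using image_0 I[OF j] by simp
qed (rule that)

lemma lift_Suc:
  assumes M: "graded_mat n (a (Suc i)) c M" and cyc: "D i * M = 0\<^sub>m (length (a i)) (length c)"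
  obtains X where "graded_mat n (a (Suc (Suc i))) c X" "D (Suc i) * X = M"
proof (rule graded_lift[OF graded M])
  fix j assume j: "j < length c"
  have Mj: "col M j \<in> free_module n (length (a (Suc i)))" using M j by (rule graded_mat_col)
  have "D i *\<^sub>v col M j = col (D i * M) j"
    using col_mult2[OF D_carrier graded_mat_carrier[OF M] j] by simp
  also have "\<dots> = 0\<^sub>v (length (a i))" using cyc j by simp
  finally have "col M j \<in> mat_kernel (D i)"
    using Mj by (intro mat_kernelI[OF D_carrier]) (auto simp: free_module_def)
  then show "col M j \<in> (\<lambda>v. D (Suc i) *\<^sub>v v) ` free_module n (length (a (Suc (Suc i))))"
    using Mj unfolding image_Suc by simp
qed (rule that)

end

lemma chain_map_exists:
  fixes I :: "'k::field mpoly set"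
  assumes F: "graded_resolution n I a D" and G: "graded_resolution n I a' D'"
  shows "\<exists>\<phi>. \<phi> 0 = 1\<^sub>m 1 \<and> (\<forall>i. graded_mat n (a' i) (a i) (\<phi> i)) \<and>
    (\<forall>i. D' i * \<phi> (Suc i) = \<phi> i * D i)"
proof -
  interpret F: graded_resolution n I a D by fact
  interpret G: graded_resolution n I a' D' by fact
  \<comment> \<open>To be liftable, the next right-hand side \<open>x * D i\<close> must be a cycle,
    so the recursion carries this along. For \<open>i = 0\<close>, membership of the entries of
    \<open>D 0\<close> in the ideal takes its place.\<close>
  define P where "P i x \<longleftrightarrow> graded_mat n (a' i) (a i) x \<and> (i = 0 \<longrightarrow> x = 1\<^sub>m 1) \<and>
    (\<forall>j. i = Suc j \<longrightarrow> D' j * (x * D i) = 0\<^sub>m (length (a' j)) (length (a (Suc i))))" for i x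
  have "\<exists>\<phi>. \<forall>i. P i (\<phi> i) \<and> D' i * \<phi> (Suc i) = \<phi> i * D i"
  proof (rule dependent_nat_choice)
    have "P 0 (1\<^sub>m 1)" using graded_mat_one[of n "[0]"] by (simp add: P_def F.a_0 G.a_0)
    then show "\<exists>x. P 0 x" by (rule exI)
    fix x i assume x: "P i x"
    then have xg: "graded_mat n (a' i) (a i) x" by (simp add: P_def)
    have xD: "graded_mat n (a' i) (a (Suc i)) (x * D i)" by (rule graded_mat_mult[OF xg F.graded])
    obtain y where y: "graded_mat n (a' (Suc i)) (a (Suc i)) y" "D' i * y = x * D i"
    proof (cases i)
      case 0
      then have "x * D 0 = D 0" using x F.D_carrier[of 0] by (simp add: P_def F.a_0)
      then show thesis using G.lift_0[of "a (Suc 0)" "x * D 0"] xD F.col_D_0 that 0 by auto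
    next
      case (Suc j)
      then show thesis using G.lift_Suc[of j "a (Suc i)" "x * D i"] xD x that by (auto simp: P_def)
    qed
    have "D' i * (y * D (Suc i)) = (D' i * y) * D (Suc i)"
      by (rule assoc_mult_mat[symmetric, OF G.D_carrier graded_mat_carrier[OF y(1)] F.D_carrier])
    also have "\<dots> = x * (D i * D (Suc i))"
      unfolding y(2) by (rule assoc_mult_mat[OF graded_mat_carrier[OF xg] F.D_carrier F.D_carrier])
    also have "\<dots> = 0\<^sub>m (length (a' i)) (length (a (Suc (Suc i))))"
      using graded_mat_carrier[OF xg] by (simp add: F.D_D)
    finally have "P (Suc i) y" using y(1) by (simp add: P_def)
    then show "\<exists>y. P (Suc i) y \<and> D' i * y = x * D i" using y(2) by blast
  qed
  then show ?thesis unfolding P_def by blast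
qed

lemma shift_count_le:
  fixes I :: "'k::field mpoly set"
  assumes F: "graded_resolution n I a D" and G: "graded_resolution n I a' D'"
  shows "count_list (a i) j \<le> count_list (a' i) j"
proof (cases i)
  case 0
  then show ?thesis using graded_resolution.a_0[OF F] graded_resolution.a_0[OF G] by simp
next
  case (Suc k)
  interpret F: graded_resolution n I a D by fact
  interpret G: graded_resolution n I a' D' by fact
  obtain \<phi> :: "nat \<Rightarrow> 'k mpoly mat" where \<phi>: "\<phi> 0 = 1\<^sub>m 1" "\<And>i. graded_mat n (a' i) (a i) (\<phi> i)"
    "\<And>i. D' i * \<phi> (Suc i) = \<phi> i * D i" using chain_map_exists[OF F G] by blast
  obtain \<psi> :: "nat \<Rightarrow> 'k mpoly mat" where \<psi>: "\<psi> 0 = 1\<^sub>m 1" "\<And>i. graded_mat n (a i) (a' i) (\<psi> i)"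
    "\<And>i. D i * \<psi> (Suc i) = \<psi> i * D' i" using chain_map_exists[OF G F] by blast
  note c\<phi> = graded_mat_carrier[OF \<phi>(2)] and c\<psi> = graded_mat_carrier[OF \<psi>(2)]
  note cD = F.D_carrier and cD' = G.D_carrier
  define \<theta> where "\<theta> i = \<psi> i * \<phi> i - 1\<^sub>m (length (a i))" for i
  have g\<theta>: "graded_mat n (a i) (a i) (\<theta> i)" for i
    unfolding \<theta>_def by (intro graded_mat_minus graded_mat_mult[OF \<psi>(2) \<phi>(2)] graded_mat_one)
  note c\<theta> = graded_mat_carrier[OF g\<theta>]
  have \<theta>0: "\<theta> 0 = 0\<^sub>m (length (a 0)) (length (a 0))"
    by (simp add: \<theta>_def \<phi>(1) \<psi>(1) F.a_0)
  have chain: "D i * \<theta> (Suc i) = \<theta> i * D i" for i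
  proof -
    have c: "\<psi> i * \<phi> i \<in> carrier_mat (length (a i)) (length (a i))" for i
      using c\<psi> c\<phi> by (rule mult_carrier_mat)
    have "D i * \<theta> (Suc i) = D i * (\<psi> (Suc i) * \<phi> (Suc i)) - D i * 1\<^sub>m (length (a (Suc i)))"
      unfolding \<theta>_def by (rule mult_minus_distrib_mat[OF cD c one_carrier_mat])
    also have "D i * (\<psi> (Suc i) * \<phi> (Suc i)) = (D i * \<psi> (Suc i)) * \<phi> (Suc i)"
      by (rule assoc_mult_mat[symmetric, OF cD c\<psi> c\<phi>])
    also have "\<dots> = \<psi> i * (D' i * \<phi> (Suc i))" unfolding \<psi>(3) by (rule assoc_mult_mat[OF c\<psi> cD' c\<phi>])
    also have "\<dots> = (\<psi> i * \<phi> i) * D i" unfolding \<phi>(3) by (rule assoc_mult_mat[symmetric, OF c\<psi> c\<phi> cD])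
    also have "D i * 1\<^sub>m (length (a (Suc i))) = 1\<^sub>m (length (a i)) * D i"
      by (simp only: right_mult_one_mat[OF cD] left_mult_one_mat[OF cD])
    also have "(\<psi> i * \<phi> i) * D i - 1\<^sub>m (length (a i)) * D i = \<theta> i * D i"
      unfolding \<theta>_def by (rule minus_mult_distrib_mat[symmetric, OF c one_carrier_mat cD])
    finally show ?thesis .
  qed
  \<comment> \<open>\<open>x\<close> is the homotopy from degree \<open>i\<close> to
    \<open>i + 1\<close>. The invariant says that the part of \<open>\<theta> (Suc i)\<close> not
    yet accounted for consists of cycles, so it lifts to the next component of the homotopy.\<close>
  define P where "P i x \<longleftrightarrow> graded_mat n (a (Suc i)) (a i) x \<and>
    D i * (\<theta> (Suc i) - x * D i) = 0\<^sub>m (length (a i)) (length (a (Suc i)))" for i x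
  have "\<exists>s. \<forall>i. P i (s i) \<and> D (Suc i) * s (Suc i) = \<theta> (Suc i) - s i * D i"
  proof (rule dependent_nat_choice)
    \<comment> \<open>The homotopy can start with zero, since both comparison maps are the identity
      in degree 0 and hence \<open>\<theta> 0\<close> vanishes.\<close>
    have "P 0 (0\<^sub>m (length (a (Suc 0))) (length (a 0)))"
    proof -
      have "\<theta> (Suc 0) - 0\<^sub>m (length (a (Suc 0))) (length (a 0)) * D 0 = \<theta> (Suc 0)"
        unfolding left_mult_zero_mat[OF cD] using c\<theta>[of "Suc 0"] by (intro eq_matI) auto
      then show ?thesis
        using cD[of 0] unfolding P_def by (simp add: chain \<theta>0 graded_mat_zero)
    qed
    then show "\<exists>x. P 0 x" by (rule exI)
    fix x i assume x: "P i x"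
    then have gx: "graded_mat n (a (Suc i)) (a i) x" by (simp add: P_def)
    note cx = graded_mat_carrier[OF gx]
    have "graded_mat n (a (Suc i)) (a (Suc i)) (\<theta> (Suc i) - x * D i)"
      by (intro graded_mat_minus g\<theta> graded_mat_mult[OF gx F.graded])
    then obtain y where y: "graded_mat n (a (Suc (Suc i))) (a (Suc i)) y"
        "D (Suc i) * y = \<theta> (Suc i) - x * D i"
      using F.lift_Suc x unfolding P_def by metis
    note cy = graded_mat_carrier[OF y(1)]
    have xD: "x * D i \<in> carrier_mat (length (a (Suc i))) (length (a (Suc i)))"
      using cx cD by (rule mult_carrier_mat)
    have yD: "y * D (Suc i) \<in> carrier_mat (length (a (Suc (Suc i)))) (length (a (Suc (Suc i))))"
      using cy cD by (rule mult_carrier_mat)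
    have T: "\<theta> (Suc i) * D (Suc i) \<in> carrier_mat (length (a (Suc i))) (length (a (Suc (Suc i))))"
      using c\<theta> cD by (rule mult_carrier_mat)
    have "D (Suc i) * (\<theta> (Suc (Suc i)) - y * D (Suc i)) =
        \<theta> (Suc i) * D (Suc i) - D (Suc i) * (y * D (Suc i))"
      by (subst mult_minus_distrib_mat[OF cD c\<theta> yD]) (simp add: chain)
    also have "D (Suc i) * (y * D (Suc i)) = (\<theta> (Suc i) - x * D i) * D (Suc i)"
      unfolding y(2)[symmetric] by (rule assoc_mult_mat[symmetric, OF cD cy cD])
    also have "\<dots> = \<theta> (Suc i) * D (Suc i) - x * D i * D (Suc i)"
      by (rule minus_mult_distrib_mat[OF c\<theta> xD cD])
    also have "x * D i * D (Suc i) = x * (D i * D (Suc i))" by (rule assoc_mult_mat[OF cx cD cD])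
    also have "\<dots> = 0\<^sub>m (length (a (Suc i))) (length (a (Suc (Suc i))))" using cx by (simp add: F.D_D)
    also have "\<theta> (Suc i) * D (Suc i) - (\<theta> (Suc i) * D (Suc i) -
        0\<^sub>m (length (a (Suc i))) (length (a (Suc (Suc i))))) =
        0\<^sub>m (length (a (Suc i))) (length (a (Suc (Suc i))))"
      using T by (intro eq_matI) auto
    finally have "P (Suc i) y" using y(1) by (simp add: P_def)
    then show "\<exists>y. P (Suc i) y \<and> D (Suc i) * y = \<theta> (Suc i) - x * D i" using y(2) by blast
  qed
  then obtain s where s: "\<And>i. P i (s i)" "\<And>i. D (Suc i) * s (Suc i) = \<theta> (Suc i) - s i * D i"
    by blast
  have cs: "s i \<in> carrier_mat (length (a (Suc i))) (length (a i))" for i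
    using s(1)[of i] graded_mat_carrier by (auto simp: P_def)
  define b b' where "b = a i" and "b' = a' i"
  define p q where "p r l = Poly_Mapping.lookup (\<psi> i $$ (r, l)) 0"
    and "q l c = Poly_Mapping.lookup (\<phi> i $$ (l, c)) 0" for r l c
  have sum0: "Poly_Mapping.lookup ((M * N) $$ (r, c)) 0 =
      (\<Sum>l<m. Poly_Mapping.lookup (M $$ (r, l)) 0 * Poly_Mapping.lookup (N $$ (l, c)) 0)"
    if "M \<in> carrier_mat u m" "N \<in> carrier_mat m v" "r < u" "c < v" for M N :: "'k mpoly mat" and u m v r c
    using that by (simp add: scalar_prod_def lookup_sum lookup_mult_0 lessThan_atLeast0)
  have pq: "(\<Sum>l<length b'. p r l * q l c) = (if r = c then 1 else 0)"
    if rc: "r < length b" "c < length b" for r c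
  proof -
    have rc': "r < length (a (Suc k))" "c < length (a (Suc k))" using rc by (auto simp: b_def Suc)
    \<comment> \<open>In each of the two summands one factor is a differential, whose entries have
      no constant term.\<close>
    have "\<theta> (Suc k) = D (Suc k) * s (Suc k) + s k * D k"
      unfolding s(2) using c\<theta>[of "Suc k"] cs[of k] cD[of k] by (intro eq_matI) auto
    moreover have "Poly_Mapping.lookup ((D (Suc k) * s (Suc k)) $$ (r, c)) 0 = 0"
      using rc' by (simp add: sum0[OF cD cs] F.const_0)
    moreover have "Poly_Mapping.lookup ((s k * D k) $$ (r, c)) 0 = 0"
      using rc' by (simp add: sum0[OF cs cD] F.const_0)
    moreover have "(D (Suc k) * s (Suc k) + s k * D k) $$ (r, c) =
        (D (Suc k) * s (Suc k)) $$ (r, c) + (s k * D k) $$ (r, c)"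
      using cs[of k] cD[of k] rc' by (intro index_add_mat) auto
    ultimately have "Poly_Mapping.lookup (\<theta> i $$ (r, c)) 0 = 0"
      using rc' Suc by (simp add: lookup_add)
    moreover have "\<theta> i $$ (r, c) = (\<psi> i * \<phi> i) $$ (r, c) - (if r = c then 1 else 0)"
      using rc c\<phi>[of i] c\<psi>[of i] by (simp add: \<theta>_def b_def)
    ultimately have "Poly_Mapping.lookup ((\<psi> i * \<phi> i) $$ (r, c)) 0 = (if r = c then 1 else 0)"
      by (auto simp: lookup_minus split: if_splits)
    then show ?thesis using rc by (simp add: sum0[OF c\<psi> c\<phi>] p_def q_def b_def b'_def)
  qed
  have "card {r. r < length b \<and> b ! r = j} \<le> card {r. r < length b' \<and> b' ! r = j}"
  proof (rule card_le_of_factorization)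
    fix r c assume "r \<in> {r. r < length b \<and> b ! r = j}" "c \<in> {r. r < length b \<and> b ! r = j}"
    then have rc: "r < length b" "c < length b" "b ! r = j" by auto
    \<comment> \<open>An entry between generators of different degrees is homogeneous of nonzero
      degree, so it has no constant term. Hence the identity on the generators of degree
      \<open>j\<close> factors through those of degree \<open>j\<close> in the other
      resolution.\<close>
    have "p r l = 0" if "l < length b'" "b' ! l \<noteq> j" for l
    proof (rule ccontr)
      assume "p r l \<noteq> 0"
      moreover have "homogeneous (b' ! l - b ! r) (\<psi> i $$ (r, l))"
        using \<psi>(2)[of i] rc(1) that(1) unfolding graded_mat_def b_def b'_def by blast
      ultimately have "b' ! l - b ! r = 0" unfolding p_def by (rule homogeneous_const[rotated])
      then show False using that rc by simp
    qed
    then have "(\<Sum>l | l < length b' \<and> b' ! l = j. p r l * q l c) = (\<Sum>l<length b'. p r l * q l c)"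
      by (intro sum.mono_neutral_left) auto
    then show "(\<Sum>l | l < length b' \<and> b' ! l = j. p r l * q l c) = (if r = c then 1 else 0)"
      using pq rc by simp
  qed auto
  then show ?thesis unfolding count_list_conv_card b_def b'_def .
qed

lemma betti_eq:
  assumes R: "minimal_graded_free_resolution n I a D"
  shows "betti n I i j = count_list (a i) j"
  unfolding betti_def
proof (rule the_equality)
  show "\<exists>a' D'. minimal_graded_free_resolution n I a' D' \<and> count_list (a i) j = count_list (a' i) j"
    using R by blast
  fix b assume "\<exists>a' D'. minimal_graded_free_resolution n I a' D' \<and> b = count_list (a' i) j"
  then obtain a' D' where R': "minimal_graded_free_resolution n I a' D'" "b = count_list (a' i) j" by blast
  have "graded_resolution n I a D" "graded_resolution n I a' D'"
    using R R'(1) by (auto intro: graded_resolution.intro)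
  then show "b = count_list (a i) j"
    using shift_count_le R'(2) by (intro antisym) blast+
qed

section \<open>The path ideal of the cycle\<close>

text \<open>After minimization the Betti numbers count basis elements by homological degree and size
  of the multidegree. The bounds and the surviving corner then determine both maxima.\<close>

lemma invariants_of_corner:
  fixes I :: "nat set set"
  assumes R: "resolvable_within TYPE('k::field) I {1..n} P r True" and proper: "{} \<notin> I"
  shows "proj_dim n (squarefree_ideal n I :: 'k mpoly set) = P \<and>
    regularity n (squarefree_ideal n I :: 'k mpoly set) = int r"
proof -
  obtain Q where Q: "resolvable TYPE('k) I {1..n} Q" "\<forall>(i, j)\<in>Q. i \<le> P \<and> j \<le> r + i" "(P, r + P) \<in> Q"
    using R unfolding resolvable_within_def by blast
  obtain B :: "nat set" and h \<mu> and d :: "nat \<Rightarrow> nat \<Rightarrow> 'k" and z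
    where S: "scalar_resolution I B h \<mu> d z" and U: "\<forall>b\<in>B. \<mu> b \<subseteq> {1..n}"
      and BQ: "(\<lambda>b. (h b, card (\<mu> b))) ` B = Q"
    using Q(1) unfolding resolvable_def by blast
  have "h b \<le> P \<and> card (\<mu> b) \<le> r + h b" if "b \<in> B" for b
    using Q(2) BQ that by blast
  moreover have "\<exists>b\<in>B. h b = P \<and> card (\<mu> b) = r + P" using Q(3) BQ by auto
  ultimately obtain B' and d' :: "nat \<Rightarrow> nat \<Rightarrow> 'k" where B': "B' \<subseteq> B"
    and S': "scalar_resolution I B' h \<mu> d' z" and min: "\<forall>b c. d' b c \<noteq> 0 \<longrightarrow> \<mu> b \<noteq> \<mu> c"
    and corner: "\<exists>b\<in>B'. h b = P \<and> card (\<mu> b) = r + P"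
    using minimize[OF S proper, of P r] by blast
  have bound: "h b \<le> P \<and> card (\<mu> b) \<le> r + h b" if "b \<in> B'" for b
    using Q(2) BQ B' that by blast
  have finB: "finite B'" using S' by (rule scalar_resolution.fin)
  define bs where "bs i = sorted_list_of_set {b \<in> B'. h b = i}" for i
  have "minimal_polynomial_resolution I B' h \<mu> d' z n bs"
    by (intro minimal_polynomial_resolution.intro polynomial_resolution.intro S'
        polynomial_resolution_axioms.intro minimal_polynomial_resolution_axioms.intro)
      (use U B' min finB in \<open>auto simp: bs_def\<close>)
  then interpret M: minimal_polynomial_resolution I B' h \<mu> d' z n bs .
  let ?I = "squarefree_ideal n I :: 'k mpoly set"
  have "betti n ?I i j = count_list (M.shifts i) j" for i j
    using M.minimal_resolution by (rule betti_eq)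
  then have "betti n ?I i j \<noteq> 0 \<longleftrightarrow> j \<in> set (M.shifts i)" for i j by (simp add: count_list_0_iff)
  then have betti: "betti n ?I i j \<noteq> 0 \<longleftrightarrow> (\<exists>b\<in>B'. h b = i \<and> int (card (\<mu> b)) = j)" for i j
    unfolding M.shifts_def set_map M.bs(2) by auto
  have pd: "{i. \<exists>j. betti n ?I i j \<noteq> 0} = h ` B'" unfolding betti by auto
  have reg: "{j - int i | i j. betti n ?I i j \<noteq> 0} = (\<lambda>b. int (card (\<mu> b)) - int (h b)) ` B'"
    unfolding betti by auto
  obtain b where b: "b \<in> B'" "h b = P" "card (\<mu> b) = r + P" using corner by blast
  have "Max (h ` B') = P"
    by (rule Max_eqI) (use finB bound b in auto)
  moreover have "Max ((\<lambda>b. int (card (\<mu> b)) - int (h b)) ` B') = int r"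
  proof (rule Max_eqI)
    show "int r \<in> (\<lambda>b. int (card (\<mu> b)) - int (h b)) ` B'"
      using b by (intro image_eqI[of _ _ b]) auto
    show "y \<le> int r" if "y \<in> (\<lambda>b. int (card (\<mu> b)) - int (h b)) ` B'" for y
      using that bound by fastforce
  qed (use finB in simp)
  ultimately show ?thesis unfolding proj_dim_def regularity_def pd reg by simp
qed

lemma ideal_gen_monomials:
  fixes S :: "'i \<Rightarrow> nat set"
  assumes fin: "finite A" and S: "\<And>i. i \<in> A \<Longrightarrow> finite (S i)"
    and bounded: "\<And>i. i \<in> A \<Longrightarrow> S i \<subseteq> {1..n}"
  shows "ideal_gen n ((\<lambda>i. Poly_Mapping.single (chi (S i)) 1) ` A) =
    (squarefree_ideal n {\<sigma>. \<exists>i\<in>A. S i \<subseteq> \<sigma>} :: 'k::field mpoly set)"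
proof (intro equalityI subsetI)
  let ?G = "(\<lambda>i. Poly_Mapping.single (chi (S i)) (1 :: 'k)) ` A"
  let ?J = "squarefree_ideal n {\<sigma>. \<exists>i\<in>A. S i \<subseteq> \<sigma>} :: 'k mpoly set"
  {
    fix f assume "f \<in> ideal_gen n ?G"
    then obtain T c where f: "f = (\<Sum>g\<in>T. c g * g)" and T: "T \<subseteq> ?G" "\<forall>g\<in>T. c g \<in> polys n"
      unfolding ideal_gen_def by blast
    have G: "g \<in> polys n" if gG: "g \<in> ?G" for g
    proof -
      obtain i where "i \<in> A" "g = Poly_Mapping.single (chi (S i)) 1" using gG by blast
      then show ?thesis using bounded[of i] S[of i] by (simp add: polys_single keys_chi)
    qed
    have "Poly_Mapping.keys m \<in> {\<sigma>. \<exists>i\<in>A. S i \<subseteq> \<sigma>}" if m: "m \<in> Poly_Mapping.keys f" for m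
    proof -
      obtain g where g: "g \<in> T" "m \<in> Poly_Mapping.keys (c g * g)"
        using subsetD[OF keys_sum m[unfolded f]] by (rule UN_E)
      obtain i where i: "i \<in> A" "g = Poly_Mapping.single (chi (S i)) 1" using g(1) T(1) by blast
      obtain l where l: "m = l + chi (S i)" using g(2) keys_mult[of "c g" g] i(2) by auto
      have "S i \<subseteq> Poly_Mapping.keys m"
        using S[OF i(1)] unfolding l by (auto simp: in_keys_iff lookup_add lookup_chi)
      then show ?thesis using i(1) by blast
    qed
    moreover have "f \<in> polys n" unfolding f using T G by (intro polys_sum polys_mult) auto
    ultimately show "f \<in> ?J" unfolding squarefree_ideal_def by blast
  next
    fix f assume f: "f \<in> ?J"
    have "\<exists>i. i \<in> A \<and> S i \<subseteq> Poly_Mapping.keys m" if "m \<in> Poly_Mapping.keys f" for m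
      using f that unfolding squarefree_ideal_def by blast
    then obtain i where i: "\<And>m. m \<in> Poly_Mapping.keys f \<Longrightarrow> i m \<in> A"
      "\<And>m. m \<in> Poly_Mapping.keys f \<Longrightarrow> S (i m) \<subseteq> Poly_Mapping.keys m" by metis
    define g where "g m = Poly_Mapping.single (chi (S (i m))) (1 :: 'k)" for m
    \<comment> \<open>The monomials of \<open>f\<close> are grouped by the generator chosen for
      them. Grouping by its value, not by its index, is right even if several indices give the same
      generator.\<close>
    define c where "c y = (\<Sum>m | m \<in> Poly_Mapping.keys f \<and> g m = y.
      Poly_Mapping.single (m - chi (S (i m))) (Poly_Mapping.lookup f m))" for y
    have "(\<Sum>y\<in>?G. c y * y) = (\<Sum>y\<in>?G. \<Sum>m | m \<in> Poly_Mapping.keys f \<and> g m = y.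
        Poly_Mapping.single m (Poly_Mapping.lookup f m))"
    proof (rule sum.cong[OF refl])
      fix y
      have "Poly_Mapping.single (m - chi (S (i m))) (Poly_Mapping.lookup f m) * y =
          Poly_Mapping.single m (Poly_Mapping.lookup f m)"
        if "m \<in> Poly_Mapping.keys f" "g m = y" for m
        using chi_minus[OF S[OF i(1)[OF that(1)]] i(2)[OF that(1)]] that(2)
        by (auto simp: g_def mult_single add.commute)
      then show "c y * y = (\<Sum>m | m \<in> Poly_Mapping.keys f \<and> g m = y.
          Poly_Mapping.single m (Poly_Mapping.lookup f m))"
        unfolding c_def sum_distrib_right by (intro sum.cong) auto
    qed
    also have "\<dots> = (\<Sum>m\<in>Poly_Mapping.keys f. Poly_Mapping.single m (Poly_Mapping.lookup f m))"
      using fin i(1) by (intro sum.group) (auto simp: g_def)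
    also have "\<dots> = f"
      by (intro poly_mapping_eqI) (auto simp: lookup_sum lookup_single when_def in_keys_iff)
    finally have "f = (\<Sum>y\<in>?G. c y * y)" by simp
    moreover have "c y \<in> polys n" for y
      unfolding c_def
    proof (intro polys_sum polys_single)
      fix m assume "m \<in> {m \<in> Poly_Mapping.keys f. g m = y}"
      then have "Poly_Mapping.keys m \<subseteq> {1..n}" using f unfolding squarefree_ideal_def polys_def by blast
      then show "Poly_Mapping.keys (m - chi (S (i m))) \<subseteq> {1..n}" using keys_minus_nat by blast
    qed
    ultimately show "f \<in> ideal_gen n ?G" unfolding ideal_gen_def using fin by blast
  }
qed

section \<open>Cyclic paths as sets of vertices\<close>

definition cycle_path :: "nat \<Rightarrow> nat \<Rightarrow> nat \<Rightarrow> nat set" where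
  "cycle_path n t i = (\<lambda>j. (i - 1 + j) mod n + 1) ` {..<t}"

text \<open>With \<open>t \<le> n\<close> the \<open>t\<close> consecutive residues are distinct, so
  the product is squarefree and determined by its set of vertices.\<close>

lemma cycle_path_monomial_eq:
  assumes "t \<le> n"
  shows "(cycle_path_monomial n t i :: 'k::field mpoly) = Poly_Mapping.single (chi (cycle_path n t i)) 1"
proof -
  define v where "v j = (i - 1 + j) mod n + 1" for j
  have "inj_on v {..<t}"
  proof (rule inj_onI)
    fix j j' assume jj': "j \<in> {..<t}" "j' \<in> {..<t}" "v j = v j'"
    have "j = j'" if "j \<le> j'" "j' < n" "(i - 1 + j) mod n = (i - 1 + j') mod n" for j j'
    proof -
      have "n dvd (i - 1 + j') - (i - 1 + j)"
        using that mod_eq_dvd_iff_nat[of "i - 1 + j" "i - 1 + j'" n] by simp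
      then have "n dvd j' - j" by simp
      then have "j' - j = 0" using that(2) by (meson dvd_imp_le less_imp_diff_less not_less neq0_conv)
      then show ?thesis using that(1) by simp
    qed
    from this[of j j'] this[of j' j] show "j = j'"
      using jj' assms by (cases "j \<le> j'") (auto simp: v_def)
  qed
  then have "chi (cycle_path n t i) = (\<Sum>j<t. Poly_Mapping.single (v j) 1)"
    unfolding chi_def cycle_path_def v_def[symmetric] by (simp add: sum.reindex)
  moreover have "(\<Prod>j<s. Var (v j)) = (Poly_Mapping.single (\<Sum>j<s. Poly_Mapping.single (v j) 1) 1 :: 'k mpoly)" for s
    by (induction s) (simp_all add: Var_def mult_single)
  ultimately show ?thesis unfolding cycle_path_monomial_def v_def by simp
qed

lemma cycle_path_straight:
  assumes "i + t \<le> n"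
  shows "cycle_path n t (Suc i) = {i<..i+t}"
proof -
  have "cycle_path n t (Suc i) = (\<lambda>j. j + Suc i) ` {..<t}"
    unfolding cycle_path_def by (rule image_cong) (use assms in auto)
  also have "\<dots> = {i<..i+t}"
    unfolding lessThan_atLeast0 image_add_atLeastLessThan' by auto
  finally show ?thesis .
qed

lemma cycle_path_wrapped:
  assumes "1 \<le> k" "k < t" "t \<le> n"
  shows "cycle_path n t (Suc (n - t + k)) = wrapped_path n t k"
proof -
  define v where "v j = (Suc (n - t + k) - 1 + j) mod n + 1" for j
  \<comment> \<open>The path passes from \<open>n\<close> to 1 after its first \<open>t - k\<close>
    vertices.\<close>
  have "{..<t} = {0..<t-k} \<union> {t-k..<t}" using assms by auto
  then have "cycle_path n t (Suc (n - t + k)) = v ` {0..<t-k} \<union> v ` {t-k..<t}"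
    unfolding cycle_path_def v_def by (simp only: image_Un)
  also have "v ` {0..<t-k} = (\<lambda>j. j + Suc (n - t + k)) ` {0..<t-k}"
    by (rule image_cong) (use assms in \<open>auto simp: v_def\<close>)
  also have "\<dots> = {n-t+k<..n}" unfolding image_add_atLeastLessThan' using assms by auto
  also have "v ` {t-k..<t} = v ` (\<lambda>j. j + (t - k)) ` {0..<k}"
    unfolding image_add_atLeastLessThan' using assms by simp
  also have "\<dots> = Suc ` {0..<k}"
    unfolding image_image
  proof (rule image_cong[OF refl])
    fix j assume "j \<in> {0..<k}"
    then have "Suc (n - t + k) - 1 + (j + (t - k)) = n + j" "j < n" using assms by auto
    then show "v (j + (t - k)) = Suc j" unfolding v_def by simp
  qed
  also have "\<dots> = {0<..k}" by (simp add: image_Suc_atLeastLessThan atLeastSucLessThan_greaterThanLessThan) auto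
  finally show ?thesis unfolding wrapped_path_def .
qed

lemma cycle_family:
  assumes "1 \<le> t" "t \<le> n"
  shows "{\<sigma>. \<exists>i\<in>{1..n}. cycle_path n t i \<subseteq> \<sigma>} = cycle_ideal n t (t - 1)"
proof (intro equalityI subsetI)
  fix \<sigma> assume "\<sigma> \<in> {\<sigma>. \<exists>i\<in>{1..n}. cycle_path n t i \<subseteq> \<sigma>}"
  then obtain i where i: "1 \<le> i" "i \<le> n" "cycle_path n t i \<subseteq> \<sigma>" by auto
  show "\<sigma> \<in> cycle_ideal n t (t - 1)"
  proof (cases "i - 1 + t \<le> n")
    case True
    then have "{i-1<..i-1+t} \<subseteq> \<sigma>" using cycle_path_straight[OF True] i by simp
    then have "\<sigma> \<in> line_ideal t 0 n t" using True by (intro line_idealI_path[of _ "i - 1"]) auto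
    then show ?thesis unfolding cycle_ideal_def by blast
  next
    case False
    \<comment> \<open>The number of vertices of the path beyond \<open>n\<close>.\<close>
    define k where "k = i - 1 - (n - t)"
    have k: "1 \<le> k" "k < t" "i = Suc (n - t + k)" using False i assms by (auto simp: k_def)
    then have "wrapped_path n t k \<subseteq> \<sigma>" using cycle_path_wrapped[OF k(1,2) assms(2)] i(3) by simp
    moreover have "k \<le> t - 1" using k by simp
    ultimately show ?thesis using k(1) unfolding cycle_ideal_def by blast
  qed
next
  fix \<sigma> assume "\<sigma> \<in> cycle_ideal n t (t - 1)"
  then consider "\<sigma> \<in> line_ideal t 0 n t" | k where "1 \<le> k" "k \<le> t - 1" "wrapped_path n t k \<subseteq> \<sigma>"
    unfolding cycle_ideal_def by blast
  then show "\<sigma> \<in> {\<sigma>. \<exists>i\<in>{1..n}. cycle_path n t i \<subseteq> \<sigma>}"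
  proof cases
    case 1
    then obtain i where i: "i + t \<le> n" "{i<..i+t} \<subseteq> \<sigma>" by (rule line_idealE_path) simp
    then have "cycle_path n t (Suc i) \<subseteq> \<sigma>" by (simp add: cycle_path_straight)
    moreover have "Suc i \<in> {1..n}" using i(1) assms by simp
    ultimately show ?thesis by blast
  next
    case 2
    then have "cycle_path n t (Suc (n - t + k)) \<subseteq> \<sigma>" using cycle_path_wrapped[of k t n] assms by simp
    moreover have "Suc (n - t + k) \<in> {1..n}" using 2 assms by simp
    ultimately show ?thesis by blast
  qed
qed

lemma path_ideal_cycle_eq:
  assumes "1 \<le> t" "t \<le> n"
  shows "(path_ideal_cycle n t :: 'k::field mpoly set) = squarefree_ideal n (cycle_ideal n t (t - 1))"
proof -
  have "cycle_path n t i \<subseteq> {1..n}" for i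
  proof
    fix x assume "x \<in> cycle_path n t i"
    then obtain j where "x = (i - 1 + j) mod n + 1" by (auto simp: cycle_path_def)
    moreover have "(i - 1 + j) mod n < n" using assms by (intro mod_less_divisor) simp
    ultimately show "x \<in> {1..n}" by simp
  qed
  moreover have "finite (cycle_path n t i)" for i by (simp add: cycle_path_def)
  ultimately have "ideal_gen n ((\<lambda>i. Poly_Mapping.single (chi (cycle_path n t i)) 1) ` {1..n}) =
      (squarefree_ideal n {\<sigma>. \<exists>i\<in>{1..n}. cycle_path n t i \<subseteq> \<sigma>} :: 'k mpoly set)"
    by (intro ideal_gen_monomials) auto
  then show ?thesis
    unfolding path_ideal_cycle_def cycle_path_monomial_eq[OF assms(2)] cycle_family[OF assms] .
qed

theorem corollary5p5:
  fixes n t p d :: nat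
    and I :: "'k::field mpoly set"
  assumes "n \<ge> 2" and "2 \<le> t" and "t \<le> n"
    and "n = (t + 1) * p + d" and "d \<le> t"
    and "I = path_ideal_cycle n t"
  shows "proj_dim n I = (if d \<noteq> 0 then 2 * p + 1 else 2 * p) \<and>
         regularity n I = (if d \<noteq> 0 then (int t - 1) * int p + int d - 1
                           else (int t - 1) * int p)"
proof -
  let ?P = "if d = 0 then 2 * p else 2 * p + 1" and ?R = "(t - 1) * p + (d - 1)"
  have "resolvable_within TYPE('k) (cycle_ideal n t (t - 1)) {0<..n} ?P ?R True"
  proof (cases p)
    \<comment> \<open>Now \<open>n = d \<le> t \<le> n\<close>, so all cyclic paths have the same
      vertices and the ideal is principal, generated by the product of all variables.\<close>
    case 0
    then have n: "n = t" "d = t" using assms by auto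
    have "\<sigma> \<in> line_ideal t 0 n t" if "wrapped_path n t j \<subseteq> \<sigma>" for j \<sigma>
    proof (rule line_idealI_segment)
      have "{0<..0+t} \<subseteq> wrapped_path n t j" using n by (auto simp: wrapped_path_def)
      then show "{0<..0+t} \<subseteq> \<sigma>" using that by (rule order_trans)
    qed (simp add: n)
    then have "cycle_ideal n t (t - 1) = line_ideal t 0 n t" unfolding cycle_ideal_def by blast
    moreover have "resolvable_within TYPE('k) (line_ideal t 0 n t) {0<..0+n}
        (if d < t then 2 * p else 2 * p + 1) ((t - 1) * p + (if d < t then 0 else t - 1)) True"
      using assms by (intro line_ideal_resolvable) auto
    ultimately show ?thesis using n assms(2) 0 by simp
  next
    case (Suc q)
    have "resolvable_within TYPE('k) (cycle_ideal n t (t - 1)) {0<..n}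
        (if d = 0 then 2 * Suc q else 2 * Suc q + 1) ((t - 1) * Suc q + (d - 1))
        (d = 0 \<or> t - (t - 1) \<le> d)"
      using assms(2,4,5) Suc by (intro cycle_ideal_resolvable) auto
    moreover have "d = 0 \<or> t - (t - 1) \<le> d" using assms(2) by auto
    ultimately show ?thesis unfolding Suc by simp
  qed
  moreover have "{0<..n} = {1..n}" by auto
  moreover have "{} \<notin> cycle_ideal n t (t - 1)"
  proof
    assume "{} \<in> cycle_ideal n t (t - 1)"
    then consider "{} \<in> line_ideal t 0 n t" | j where "1 \<le> j" "wrapped_path n t j \<subseteq> {}"
      unfolding cycle_ideal_def by blast
    then show False
    proof cases
      case 1
      then show False using assms(2) by (auto elim: line_idealE_path)
    qed (use assms(2) in \<open>auto simp: wrapped_path_def\<close>)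
  qed
  ultimately have "proj_dim n I = ?P \<and> regularity n I = int ?R"
    using invariants_of_corner[where 'k = 'k] path_ideal_cycle_eq[of t n, where 'k = 'k] assms(2,3,6) by simp
  \<comment> \<open>The integer formula needs a case distinction because, unlike the truncated
    \<open>d - 1\<close> in \<open>?R\<close>, its \<open>int d - 1\<close> is negative for
    \<open>d = 0\<close>.\<close>
  moreover have "int ?R = (if d \<noteq> 0 then (int t - 1) * int p + int d - 1 else (int t - 1) * int p)"
    using assms(2) by (simp add: of_nat_diff)
  ultimately show ?thesis by simp
qed

end
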